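(* There exist a non-decreasing function $f:[0,1]\to[0,1]$ and an increasing function $g:[0,1]\to[0,1]$ such that the Balanced Ranking algorithm with functions $f$ and $g$ is $0.569$-competitive for (integral) fully online matching on bipartite graphs.
   Context: Fully online matching: an unknown undirected graph $G=(V,E)$ is revealed over $2|V|$ steps, each step being either the arrival or the deadline of a vertex (each vertex has exactly one arrival and one later deadline). At the arrival of $u$, the algorithm observes the edges between $u$ and previously arrived vertices. The deadline of $u$ is the last step at which $u$ can be matched, and all neighbors of $u$ arrive before $u$'s deadline. An edge can be added to the matching at any step after both endpoints have arrived and no later than the earlier of their deadlines, provided both endpoints are unmatched; decisions are irrevocable. An (integral, possibly randomized) algorithm is $\Gamma$-competitive if on every instance (graph and order of arrivals/deadlines) the expected size of its matching is at least $\Gamma$ times the size of a maximum matching of $G$. Balanced Ranking with non-decreasing $f$ and increasing $g$: at the arrival of each vertex $u$ draw a rank $y_u\in[0,1]$ uniformly at random, independently. Vertices are matched only at deadlines. At the deadline of a vertex $u$ that is still unmatched, $u$ is matched to the unmatched neighbor $v$ maximizing $1-g(y_v)-f(x_v^{(u)})$ (if any), where $x_v^{(u)}$ is the lookahead water level of $v$: the probability (over the random ranks) that $v$ is matched right after $u$'s deadline, under the algorithm itself. This is a self-consistent (fixed-point) definition: the algorithm uses numbers $\hat f_v$ in place of $f(x_v^{(u)})$ chosen so that, when $u$ is matched to the unmatched neighbor maximizing $1-g(y_v)-\hat f_v$, the resulting water levels satisfy $f(x_v^{(u)})=\hat f_v$ (the paper analyzes this limiting exact case). *)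

theory Defs
  imports "HOL-Probability.Probability"
begin

section \<open>Graphs and matchings\<close>

definition simple_graph :: "nat set \<Rightarrow> nat set set \<Rightarrow> bool" where
  "simple_graph V E \<longleftrightarrow> finite V \<and> (\<forall>e\<in>E. e \<subseteq> V \<and> card e = 2)"

definition bipartite :: "nat set \<Rightarrow> nat set set \<Rightarrow> bool" where
  "bipartite V E \<longleftrightarrow>
     (\<exists>L R. V = L \<union> R \<and> L \<inter> R = {} \<and> (\<forall>e\<in>E. \<exists>u\<in>L. \<exists>v\<in>R. e = {u, v}))"

definition matching :: "nat set set \<Rightarrow> nat set set \<Rightarrow> bool" where
  "matching E M \<longleftrightarrow> M \<subseteq> E \<and> disjoint M"

definition max_matching_size :: "nat set set \<Rightarrow> nat" where
  "max_matching_size E = Max (card ` {M. matching E M})"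


section \<open>Fully online matching\<close>

datatype event = Arrival nat | Deadline nat

definition precedes :: "'a list \<Rightarrow> 'a \<Rightarrow> 'a \<Rightarrow> bool" where
  "precedes \<sigma> a b \<longleftrightarrow> (\<exists>i j. i < j \<and> j < length \<sigma> \<and> \<sigma> ! i = a \<and> \<sigma> ! j = b)"

definition fully_online_instance :: "nat set \<Rightarrow> nat set set \<Rightarrow> event list \<Rightarrow> bool" where
  "fully_online_instance V E \<sigma> \<longleftrightarrow>
     simple_graph V E \<and>
     distinct \<sigma> \<and> set \<sigma> = Arrival ` V \<union> Deadline ` V \<and>
     (\<forall>u\<in>V. precedes \<sigma> (Arrival u) (Deadline u)) \<and>
     (\<forall>u v. {u, v} \<in> E \<longrightarrow> precedes \<sigma> (Arrival v) (Deadline u))"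

text \<open>What has been revealed after a sequence of steps: the steps themselves, and the subgraph
  induced by the vertices that have arrived.\<close>

type_synonym observation = "event list \<times> nat set set"

definition observation :: "nat set set \<Rightarrow> event list \<Rightarrow> observation" where
  "observation E es = (es, {e \<in> E. \<forall>v\<in>e. Arrival v \<in> set es})"

text \<open>An algorithm maps the current observation, its random seed and its current matching to the
  set of edges it adds in the current step. Since it never sees anything but the observation, it is
  online, and since edges are only ever added, its decisions are irrevocable.\<close>

type_synonym 's algorithm = "observation \<Rightarrow> 's \<Rightarrow> nat set set \<Rightarrow> nat set set"

fun run :: "'s algorithm \<Rightarrow> nat set set \<Rightarrow> event list \<Rightarrow> 's \<Rightarrow> nat \<Rightarrow> nat set set" where
  "run A E \<sigma> s 0 = {}"
| "run A E \<sigma> s (Suc k) =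
     run A E \<sigma> s k \<union> A (observation E (take (Suc k) \<sigma>)) s (run A E \<sigma> s k)"

text \<open>In the step with index \<open>k\<close>, a vertex may be matched if it has arrived (possibly in this very
  step), its deadline is not earlier than this step, and it is still unmatched.\<close>

definition feasible :: "'s algorithm \<Rightarrow> nat set set \<Rightarrow> event list \<Rightarrow> 's \<Rightarrow> bool" where
  "feasible A E \<sigma> s \<longleftrightarrow>
     (\<forall>k<length \<sigma>.
        let M = run A E \<sigma> s k; D = A (observation E (take (Suc k) \<sigma>)) s M in
          matching E D \<and>
          (\<forall>v\<in>\<Union>D. Arrival v \<in> set (take (Suc k) \<sigma>) \<and> Deadline v \<notin> set (take k \<sigma>) \<and> v \<notin> \<Union>M))"

text \<open>The randomized algorithm \<open>A\<close>, with seed distributed according to \<open>S\<close>, is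
  \<open>\<Gamma>\<close>-competitive on the instances whose graph belongs to the class \<open>\<G>\<close>.\<close>

definition competitive ::
  "(nat set \<Rightarrow> nat set set \<Rightarrow> bool) \<Rightarrow> 's measure \<Rightarrow> 's algorithm \<Rightarrow> real \<Rightarrow> bool" where
  "competitive \<G> S A \<Gamma> \<longleftrightarrow>
     prob_space S \<and>
     (\<forall>V E \<sigma>. fully_online_instance V E \<sigma> \<and> \<G> V E \<longrightarrow>
        (\<forall>s\<in>space S. feasible A E \<sigma> s) \<and>
        (\<integral>s. real (card (run A E \<sigma> s (length \<sigma>))) \<partial>S) \<ge> \<Gamma> * real (max_matching_size E))"


section \<open>Balanced Ranking\<close>

text \<open>Independent ranks, uniform on \<open>[0,1]\<close>. There is one for every potential vertex, so that the
  distribution does not depend on the instance; only ranks of arrived vertices are ever used.\<close>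

definition rank_space :: "(nat \<Rightarrow> real) measure" where
  "rank_space = (\<Pi>\<^sub>M v\<in>UNIV. restrict_space lborel {0..1})"

text \<open>\<open>fhat\<close> supplies the numbers used in place of \<open>f (x\<^sub>v\<^sup>u)\<close>; the deadline being
  processed, and hence \<open>u\<close>, is part of the observation. Ties in the maximum have probability zero
  when \<open>g\<close> is strictly increasing, so the tie-breaking in \<^const>\<open>arg_max_on\<close> is immaterial.\<close>

definition balanced_ranking ::
  "(real \<Rightarrow> real) \<Rightarrow> (observation \<Rightarrow> nat \<Rightarrow> real) \<Rightarrow> (nat \<Rightarrow> real) algorithm" where
  "balanced_ranking g fhat obs y M =
     (case last (fst obs) of
        Arrival _ \<Rightarrow> {}
      | Deadline u \<Rightarrow>
          let N = {v. {u, v} \<in> snd obs \<and> v \<notin> \<Union>M} in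
            if u \<in> \<Union>M \<or> N = {} then {}
            else {{u, arg_max_on (\<lambda>v. 1 - g (y v) - fhat obs v) N}})"

definition water_level ::
  "(real \<Rightarrow> real) \<Rightarrow> (observation \<Rightarrow> nat \<Rightarrow> real) \<Rightarrow> nat set set \<Rightarrow> event list \<Rightarrow> nat \<Rightarrow> nat \<Rightarrow> real" where
  "water_level g fhat E \<sigma> k v =
     measure rank_space
       {y \<in> space rank_space. v \<in> \<Union>(run (balanced_ranking g fhat) E \<sigma> y k)}"

text \<open>The water levels resulting from \<open>fhat\<close> right after the deadline of \<open>u\<close> (the step with index
  \<open>k\<close>, so after \<open>Suc k\<close> steps) are those on which \<open>fhat\<close> claims to be based.\<close>

definition self_consistent ::
  "(nat set \<Rightarrow> nat set set \<Rightarrow> bool) \<Rightarrow> (real \<Rightarrow> real) \<Rightarrow> (real \<Rightarrow> real) \<Rightarrow>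
   (observation \<Rightarrow> nat \<Rightarrow> real) \<Rightarrow> bool" where
  "self_consistent \<G> f g fhat \<longleftrightarrow>
     (\<forall>V E \<sigma>. fully_online_instance V E \<sigma> \<and> \<G> V E \<longrightarrow>
        (\<forall>k<length \<sigma>. \<forall>u v. \<sigma> ! k = Deadline u \<and> {u, v} \<in> E \<longrightarrow>
           f (water_level g fhat E \<sigma> (Suc k) v) = fhat (observation E (take (Suc k) \<sigma>)) v))"

text \<open>The fixed-point definition need not determine \<open>fhat\<close> uniquely, nor need a fixed point exist
  for arbitrary \<open>f\<close>. Competitiveness of Balanced Ranking therefore means that the algorithm is
  well-defined, and that the guarantee holds for every self-consistent choice of the numbers.\<close>

definition balanced_ranking_competitive ::
  "(nat set \<Rightarrow> nat set set \<Rightarrow> bool) \<Rightarrow> (real \<Rightarrow> real) \<Rightarrow> (real \<Rightarrow> real) \<Rightarrow> real \<Rightarrow> bool" where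
  "balanced_ranking_competitive \<G> f g \<Gamma> \<longleftrightarrow>
     (\<exists>fhat. self_consistent \<G> f g fhat) \<and>
     (\<forall>fhat. self_consistent \<G> f g fhat \<longrightarrow>
        competitive \<G> rank_space (balanced_ranking g fhat) \<Gamma>)"

end

theory Submission imports Defs begin

text \<open>A matched pair splits one unit of gain: the passive vertex \<open>v\<close> gets \<open>g (y v) + f (x v)\<close>, the active
  one (whose deadline triggers the match) the rest. It suffices that for every edge \<open>{u, v}\<close> of a
  maximum matching, with \<open>u\<close> having the earlier deadline, the expected gain of \<open>u\<close> and \<open>v\<close> is at
  least \<open>0.569\<close>. Since \<open>f\<close> is monotone, the \<open>f\<close>-part collected passively by a vertex of water level
  \<open>p\<close> is at least the integral \<open>F p\<close> of \<open>f\<close>; this is bounded below by a fixed tangent for \<open>u\<close> and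
  compared with \<open>f (x v)\<close> for \<open>v\<close>. For the rest, fix all ranks but \<open>y u\<close> and \<open>y v\<close>. There are three
  thresholds: \<open>u\<close> is matched passively when \<open>y u < \<tau>\<close>, \<open>v\<close> is matched before \<open>u\<close>'s deadline when
  \<open>y v < t\<close>, and \<open>u\<close>, if still free, takes \<open>v\<close> when \<open>t < y v < \<theta>\<close>. Integrating over the unit square
  leaves an explicit inequality in \<open>\<tau>\<close>, \<open>t\<close>, \<open>\<theta>\<close> and \<open>f (x v)\<close>. The function \<open>g\<close> is chosen so that
  \<open>(1 - \<theta>) * g \<theta>\<close> is constant up to \<open>2/5\<close> and \<open>g' \<le> g\<close> afterwards, which makes \<open>\<theta> = 2/5\<close> and
  \<open>\<theta> = 1\<close> the only critical values.

  The lookahead values of one step exist by a Knaster-Tarski argument: the water level of \<open>v\<close> is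
  antitone and continuous in the number used for \<open>v\<close>, and monotone in the others.\<close>

section \<open>The functions and the numerical inequality\<close>

text \<open>The thresholds interact: whether \<open>u\<close> is still free depends on the rank of
  \<open>v\<close>, and conversely. Hence \<open>\<tau>\<close> is taken in the graph without
  \<open>v\<close>, \<open>t\<close> in the graph without \<open>u\<close>, and the alternatives
  behind \<open>\<theta>\<close> in the graph without both, so that none of them depends on the two
  varying ranks. In a bipartite graph, putting one endpoint of the edge back can only help the
  other, so matches predicted by \<open>\<tau>\<close> or \<open>t\<close> survive. The prediction
  is incomplete for \<open>y u > \<tau>\<close> and \<open>y v < t\<close>, where the presence of
  \<open>v\<close> may get \<open>u\<close> matched early; there the smaller of two incomes is
  counted.

  The water level of \<open>u\<close> is not tied to \<open>\<phi> = f (x v)\<close>. Bounding the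
  convex \<open>F\<close> by the line through its last, affine piece turns it into a credit
  \<open>77/1000\<close> per passive match at the fixed cost \<open>76/10000\<close>. The water
  level of \<open>v\<close> enters only through \<open>\<phi>\<close>, quadratically because
  \<open>br_f\<close> is affine until it saturates.

  A lookahead number may depend only on what has been revealed, so its fixed point is formulated for
  the observation rather than for the instance.\<close>

definition br_f :: "real \<Rightarrow> real" where
  "br_f x = min (39/1000 + 95/1000 * x) (77/1000)"

text \<open>\<open>br_F\<close> and \<open>br_G\<close> are the integrals of \<open>br_f\<close> and \<open>br_g\<close> from \<open>0\<close>.\<close>

definition br_F :: "real \<Rightarrow> real" where
  "br_F x = (if x \<le> 2/5 then 39/1000 * x + 95/2000 * x\<^sup>2 else 77/1000 * x - 76/10000)"

definition br_g :: "real \<Rightarrow> real" where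
  "br_g y = (if y \<le> 2/5 then 319/1000 / (1 - y) else 319/600 * (3/5 + y))"

definition br_G :: "real \<Rightarrow> real" where
  "br_G y = (if y \<le> 2/5 then - (319/1000) * ln (1 - y)
     else 319/1000 * ln (5/3) + 319/600 * ((y - 2/5) + (y - 2/5)\<^sup>2 / 2))"

section \<open>Estimates for \<open>br_f\<close>, \<open>br_g\<close> and their integrals\<close>

lemma br_f_bounds: "0 \<le> x \<Longrightarrow> 39/1000 \<le> br_f x" "br_f x \<le> 77/1000"
  by (auto simp: br_f_def min_def)

lemma mono_br_f: "mono br_f"
  by (auto simp: br_f_def mono_def min_def)

lemma br_F_0 [simp]: "br_F 0 = 0"
  by (simp add: br_F_def)

text \<open>\<open>br_F\<close> is convex with derivative \<open>br_f\<close>, so the slope at the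
  right endpoint dominates. This is one term of the upper Riemann sum over a water level.\<close>

lemma br_F_diff_le:
  assumes "x \<le> y"
  shows "br_F y - br_F x \<le> br_f y * (y - x)"
proof -
  consider "y \<le> 2/5" | "x \<le> 2/5" "2/5 < y" | "2/5 < x" by linarith
  then show ?thesis
  proof cases
    case 1
    then have eqs: "br_f y = 39/1000 + 95/1000 * y" "br_F y = 39/1000 * y + 95/2000 * y\<^sup>2"
      "br_F x = 39/1000 * x + 95/2000 * x\<^sup>2"
      using assms by (simp_all add: br_f_def br_F_def)
    have "br_f y * (y - x) - (br_F y - br_F x) = 95/2000 * (y - x)\<^sup>2"
      unfolding eqs by algebra
    moreover have "0 \<le> 95/2000 * (y - x)\<^sup>2" by simp
    ultimately show ?thesis by linarith
  next
    case 2
    then have eqs: "br_f y = 77/1000" "br_F y = 77/1000 * y - 76/10000"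
      "br_F x = 39/1000 * x + 95/2000 * x\<^sup>2"
      by (simp_all add: br_f_def br_F_def)
    have "br_f y * (y - x) - (br_F y - br_F x) = 95/2000 * (x - 2/5)\<^sup>2"
      unfolding eqs by algebra
    moreover have "0 \<le> 95/2000 * (x - 2/5)\<^sup>2" by simp
    ultimately show ?thesis by linarith
  next
    case 3
    then show ?thesis using assms by (simp add: br_f_def br_F_def min_def algebra_simps)
  qed
qed

text \<open>The line is the piece of \<open>br_F\<close> beyond \<open>2/5\<close>, extended to the
  left; below \<open>2/5\<close> the gap is a multiple of the square of
  \<open>p - 2/5\<close>.\<close>

lemma br_F_tangent: "77/1000 * p - 76/10000 \<le> br_F p"
proof -
  have "95/2000 * (p - 2/5)\<^sup>2 \<ge> 0" by simp
  then show ?thesis by (simp add: br_F_def power2_eq_square algebra_simps add_divide_distrib diff_divide_distrib)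
qed

text \<open>Eliminates the water level in favour of the value of \<open>br_f\<close>. On the affine
  piece, of slope \<open>95/1000\<close>, this is an equality; beyond \<open>2/5\<close> the left
  side is constant while \<open>br_F\<close> grows.\<close>

lemma br_F_ge_br_f:
  assumes "0 \<le> q"
  shows "((br_f q)\<^sup>2 - (39/1000)\<^sup>2) / (19/100) \<le> br_F q"
  using assms by (simp add: br_f_def br_F_def min_def power2_eq_square field_simps)

lemma strict_mono_br_g: "strict_mono_on {0..1} br_g"
proof (rule strict_mono_onI)
  fix x y :: real assume xy: "x \<in> {0..1}" "y \<in> {0..1}" "x < y"
  consider "y \<le> 2/5" | "x \<le> 2/5" "2/5 < y" | "2/5 < x" by linarith
  then show "br_g x < br_g y"
  proof cases
    case 2
    have "br_g x \<le> 319/600" using 2 by (simp add: br_g_def field_simps)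
    also have "\<dots> < br_g y" using 2 by (simp add: br_g_def)
    finally show ?thesis .
  qed (use xy in \<open>auto simp: br_g_def field_simps\<close>)
qed

text \<open>\<open>923/1000\<close> is \<open>1\<close> minus the maximum of \<open>br_f\<close>.
  Hence rank part and offset never add up to more than \<open>1\<close>, and the share of the active
  vertex is non-negative.\<close>

lemma br_g_bounds:
  assumes "y \<in> {0..1}"
  shows "319/1000 \<le> br_g y" "br_g y \<le> 923/1000"
  using assms by (auto simp: br_g_def field_simps)

lemma continuous_on_br_g: "continuous_on {0..1} br_g"
proof -
  have "continuous_on ({0..2/5} \<union> {2/5..1})
      (\<lambda>y. if y \<le> 2/5 then 319/1000 / (1 - y) else 319/600 * (3/5 + y :: real))"
  proof (rule continuous_on_cases)
    show "\<forall>y. y \<in> {0..2/5} \<and> \<not> y \<le> 2/5 \<or> y \<in> {2/5..1} \<and> y \<le> 2/5 \<longrightarrow>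
       319/1000 / (1 - y) = 319/600 * (3/5 + y :: real)"
    proof (intro allI impI)
      fix y :: real assume "y \<in> {0..2/5} \<and> \<not> y \<le> 2/5 \<or> y \<in> {2/5..1} \<and> y \<le> 2/5"
      then have y: "y = 2/5" by (metis atLeastAtMost_iff antisym)
      show "319/1000 / (1 - y) = 319/600 * (3/5 + y)" unfolding y by simp
    qed
  qed (auto intro!: continuous_intros)
  moreover have "{0..2/5} \<union> {2/5..1} = {0..1::real}" by auto
  ultimately show ?thesis by (simp add: br_g_def[abs_def])
qed

text \<open>The two formulas for \<open>br_G\<close> agree at \<open>2/5\<close> in value and in
  derivative, so they can be glued there.\<close>

lemma br_G_deriv:
  assumes "x \<in> {0..1}"
  shows "(br_G has_vector_derivative br_g x) (at x within {0..1})"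
proof -
  let ?G1 = "\<lambda>y::real. - (319/1000) * ln (1 - y)" and ?g1 = "\<lambda>y::real. 319/1000 / (1 - y)"
  let ?G2 = "\<lambda>y::real. 319/1000 * ln (5/3) + 319/600 * ((y - 2/5) + (y - 2/5)\<^sup>2 / 2)"
  let ?g2 = "\<lambda>y::real. 319/600 * (3/5 + y)"
  have 1: "(?G1 has_vector_derivative ?g1 y) (at y within A)" if "y \<le> 2/5" for y A
    unfolding has_real_derivative_iff_has_vector_derivative[symmetric]
    using that by (auto intro!: derivative_eq_intros simp: divide_simps)
  have 2: "(?G2 has_vector_derivative ?g2 y) (at y within A)" for y A
    unfolding has_real_derivative_iff_has_vector_derivative[symmetric]
    by (auto intro!: derivative_eq_intros simp: algebra_simps add_divide_distrib diff_divide_distrib)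
  have ln: "ln (3/5 :: real) = - ln (5/3)" by (simp add: ln_div)
  have int: "y = 2/5" if "y \<in> closure {..2/5}" "y \<in> closure {2/5..}" for y :: real
    using that by (simp only: closure_closed[OF closed_atMost] closure_closed[OF closed_atLeast] atMost_iff atLeast_iff order_antisym)
  have *: "((\<lambda>y. if y \<in> {..2/5} then ?G1 y else ?G2 y) has_vector_derivative
      (if x \<in> {..2/5} then ?g1 x else ?g2 x)) (at x within UNIV)"
  proof (rule has_vector_derivative_If_within_closures[where T = "{2/5..}"])
    show "?G1 x = ?G2 x" if "x \<in> closure {..2/5}" "x \<in> closure {2/5..}"
      unfolding int[OF that] using ln by simp
    show "?g1 x = ?g2 x" if "x \<in> closure {..2/5}" "x \<in> closure {2/5..}"
      unfolding int[OF that] by simp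
    show "(?G1 has_vector_derivative ?g1 x) (at x within {..2/5} \<union> closure {..2/5} \<inter> closure {2/5..})"
      if "x \<in> {..2/5} \<union> closure {..2/5} \<inter> closure {2/5..}"
      using that by (intro 1) (simp add: closure_closed)
    show "(?G2 has_vector_derivative ?g2 x) (at x within {2/5..} \<union> closure {..2/5} \<inter> closure {2/5..})"
      by (rule 2)

    show "x \<in> {..2/5} \<union> {2/5..}" by auto
    show "(UNIV :: real set) = {..2/5} \<union> {2/5..}" by auto
  qed
  then have "(br_G has_vector_derivative br_g x) (at x)"
    unfolding br_G_def[abs_def] br_g_def by simp
  then show ?thesis by (rule has_vector_derivative_at_within)
qed

text \<open>The one numerical evaluation of a logarithm: \<open>br_G (2/5)\<close> is
  \<open>319/1000 * ln (5/3)\<close>.\<close>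

lemma ln_5_3: "5107/10000 \<le> ln (5/3 :: real)"
  using ln_approx_bounds[of "5/3" 3] by (simp add: eval_nat_numeral)

lemma br_G_ge:
  assumes "y \<in> {0..1}"
  shows "319/1000 * y \<le> br_G y"
proof (cases "y \<le> 2/5")
  case True
  have "ln (1 - y) \<le> (1 - y) - 1" using assms True by (intro ln_le_minus_one) auto
  then show ?thesis using True by (simp add: br_G_def)
next
  case False
  have "(y - 2/5)\<^sup>2 \<ge> 0" by simp
  then have "319/600 * (y - 2/5) \<le> 319/600 * (y - 2/5 + (y - 2/5)\<^sup>2 / 2)" by simp
  then show ?thesis using False ln_5_3 unfolding br_G_def by argo
qed

lemma br_G_ge_linear:
  assumes "2/5 \<le> y"
  shows "br_G (2/5) + 319/600 * (y - 2/5) \<le> br_G y"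
proof (cases "y \<le> 2/5")
  case True
  with assms have y: "y = 2/5" by (rule antisym[rotated])
  show ?thesis unfolding y by simp
next
  case False
  have "ln (3/5 :: real) = - ln (5/3)" by (simp add: ln_div)
  moreover have "319/600 * (y - 2/5) \<le> 319/600 * (y - 2/5 + (y - 2/5)\<^sup>2 / 2)" by simp
  ultimately show ?thesis using assms False by (simp add: br_G_def)
qed

text \<open>On \<open>{0..2/5}\<close> the sum depends only on the product of \<open>1 - a\<close>
  and \<open>1 - b\<close>. The bound \<open>ln x \<le> x - 1\<close> is applied to this product
  divided by \<open>r\<close>, so \<open>r\<close> is the value of the product at which the estimate
  is tight.\<close>

lemma br_G_low:
  assumes "a \<in> {0..2/5}" "b \<in> {0..2/5}" "0 < r"
  shows "319/1000 * (1 + ln (1/r)) - 319/1000 * ((1 - a) * (1 - b)) / r \<le> br_G a + br_G b"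
proof -
  have "ln ((1 - a) * (1 - b) / r) \<le> (1 - a) * (1 - b) / r - 1"
    using assms by (intro ln_le_minus_one) auto
  moreover have "ln ((1 - a) * (1 - b) / r) = ln (1 - a) + ln (1 - b) + ln (1/r)"
    using assms by (simp add: ln_div ln_mult)
  ultimately show ?thesis using assms unfolding br_G_def by simp argo
qed

section \<open>The numerical inequality\<close>

text \<open>For fixed \<open>\<tau>\<close> the right side is a convex quadratic in
  \<open>\<phi>\<close>. If \<open>\<tau> \<le> 1/10\<close>, the last term changes the linear
  coefficient to \<open>-9/10\<close>, which puts the minimum beyond \<open>77/1000\<close>, so the
  boundary value \<open>\<phi> = 77/1000\<close> is the worst one. Otherwise the minimum is at
  \<open>95/1000 * (1 - \<tau>)\<close>, the centre of the square used below.\<close>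

lemma core_ineq_tau_le:
  fixes \<tau> \<phi> :: real
  assumes "0 \<le> \<tau>" "\<tau> \<le> 2/5" "39/1000 \<le> \<phi>" "\<phi> \<le> 77/1000"
  shows "569/1000 \<le> (\<phi>\<^sup>2 - (39/1000)\<^sup>2) / (19/100) - 76/10000 + 319/1000 * (1 + 5107/10000) + 77/1000 * \<tau>
    + (1 - \<tau>) * (1 - \<phi> - 319/1000 - 319/600) - (77/1000 - \<phi>) * max 0 (1/10 - \<tau>)"
proof (cases "\<tau> \<le> 1/10")
  case True
  have "0 \<le> (77/1000 - \<phi>)\<^sup>2" by simp
  with assms True show ?thesis
    by (simp add: max_def power2_eq_square algebra_simps add_divide_distrib diff_divide_distrib)
next
  case False
  have "0 \<le> (77/1000 - \<phi> - 95/1000 * (\<tau> - 18/95))\<^sup>2" by simp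
  \<comment> \<open>Minimising over \<open>\<phi>\<close> leaves a concave quadratic in
    \<open>\<tau>\<close>; this product reduces it to the endpoints \<open>1/10\<close> and
    \<open>2/5\<close>.\<close>
  moreover have "0 \<le> (\<tau> - 1/10) * (2/5 - \<tau>)" using assms False by simp
  ultimately show ?thesis using assms False
    by (simp add: max_def power2_eq_square algebra_simps add_divide_distrib diff_divide_distrib)
qed

lemma core_ineq_tau_ge:
  fixes \<tau> \<phi> :: real
  assumes "\<tau> \<le> 1"
  shows "569/1000 \<le> (\<phi>\<^sup>2 - (39/1000)\<^sup>2) / (19/100) - 76/10000
    + 319/1000 * (5107/10000) + 319/600 * ((\<tau> - 2/5) + (\<tau> - 2/5)\<^sup>2 / 2) + 77/1000 * \<tau>
    + (1 - \<tau>) * (1 - \<phi> - 319/1000)"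
proof -
  have "0 \<le> (\<phi> - 95/1000 * (1 - \<tau>))\<^sup>2 / (19/100)" by simp
  \<comment> \<open>After minimising over \<open>\<phi>\<close> the expression is convex in
    \<open>\<tau>\<close>, with its minimum close to \<open>435/1000\<close>.\<close>
  moreover have "0 \<le> (\<tau> - 435/1000)\<^sup>2" by simp
  ultimately show ?thesis using assms
    by (simp add: power2_eq_square algebra_simps add_divide_distrib diff_divide_distrib)
qed

text \<open>The case \<open>\<theta> = 1\<close>, with \<open>1 - \<phi>\<close> at its smallest
  value \<open>923/1000\<close>. The only interaction of \<open>\<tau>\<close> and \<open>t\<close>
  is a bilinear term, so on each piece of \<open>br_G\<close> suitable products of non-negative
  factors settle it.\<close>

lemma core_ineq_one:
  fixes \<tau> t :: real
  assumes "\<tau> \<in> {0..1}" "t \<in> {0..1}"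
  shows "569/1000 + 76/10000 \<le> br_G \<tau> + 77/1000 * \<tau> + br_G t + 923/1000 * ((1 - \<tau>) * (1 - t))"
proof -
  consider "\<tau> \<le> 2/5" "t \<le> 2/5" | "\<tau> \<le> 2/5" "2/5 < t" | "2/5 < \<tau>" "t \<le> 2/5" | "2/5 < \<tau>" "2/5 < t"
    by linarith
  then show ?thesis
  proof cases
    case 1
    \<comment> \<open>\<open>9/25\<close> makes the estimate tight at the corner
      \<open>\<tau> = t = 2/5\<close>. The product then has coefficient \<open>- 319/360\<close>,
      which is outweighed by \<open>923/1000\<close>.\<close>
    have "319/1000 * (1 + ln (1/(9/25))) - 319/1000 * ((1 - \<tau>) * (1 - t)) / (9/25) \<le> br_G \<tau> + br_G t"
      using assms 1 by (intro br_G_low) auto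
    moreover have "ln (1/(9/25) :: real) = ln ((5/3) * (5/3))" by simp
    then have "ln (1/(9/25) :: real) = 2 * ln (5/3)" by (simp only: ln_mult)  simp
    moreover have "0 \<le> (1 - \<tau>) * (1 - t)" using assms by simp
    moreover have "0 \<le> \<tau>" using assms by simp
    ultimately show ?thesis using ln_5_3 by argo
  next
    case 2
    have "319/1000 * \<tau> \<le> br_G \<tau>" using assms by (intro br_G_ge)
    moreover have "br_G t = 319/1000 * ln (5/3) + 319/600 * ((t - 2/5) + (t - 2/5)\<^sup>2 / 2)"
      using 2 by (simp add: br_G_def)
    moreover have "569/1000 + 76/10000 \<le> 319/1000 * \<tau> + 77/1000 * \<tau> + 319/1000 * (5107/10000) + 319/600 * ((t - 2/5) + (t - 2/5)\<^sup>2 / 2) + 923/1000 * ((1 - \<tau>) * (1 - t))"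
    \<comment> \<open>The coefficient of \<open>\<tau>\<close> changes sign near
      \<open>t = 3/5\<close>.\<close>
    proof (cases "t \<le> 3/5")
      case True
      have "0 \<le> (2/5 - \<tau>) * (3/5 - t)" using 2 True by simp
      moreover have "0 \<le> \<tau> * (t - 2/5)" using 2 assms by simp
      moreover have "0 \<le> (t - 2/5)\<^sup>2" by simp
      ultimately show ?thesis using 2 True assms by (simp add: power2_eq_square algebra_simps add_divide_distrib diff_divide_distrib)
    next
      case False
      have "0 \<le> \<tau> * (t - 3/5)" using False assms by simp
      moreover have "0 \<le> (1 - t)\<^sup>2" by simp
      ultimately show ?thesis using 2 False assms by (simp add: power2_eq_square algebra_simps add_divide_distrib diff_divide_distrib)
    qed
    ultimately show ?thesis using ln_5_3 by argo
  next
    case 3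
    have "319/1000 * t \<le> br_G t" using assms by (intro br_G_ge)
    moreover have "br_G \<tau> = 319/1000 * ln (5/3) + 319/600 * ((\<tau> - 2/5) + (\<tau> - 2/5)\<^sup>2 / 2)"
      using 3 by (simp add: br_G_def)
    moreover have "569/1000 + 76/10000 \<le> 319/1000 * t + 77/1000 * \<tau> + 319/1000 * (5107/10000) + 319/600 * ((\<tau> - 2/5) + (\<tau> - 2/5)\<^sup>2 / 2) + 923/1000 * ((1 - \<tau>) * (1 - t))"
    \<comment> \<open>The coefficient of \<open>t\<close> changes sign near
      \<open>\<tau> = 13/20\<close>.\<close>
    proof (cases "\<tau> \<le> 13/20")
      case True
      have "0 \<le> (2/5 - t) * (13/20 - \<tau>)" using 3 True by simp
      moreover have "0 \<le> t * (\<tau> - 2/5)" using 3 assms by simp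
      moreover have "0 \<le> (\<tau> - 2/5)\<^sup>2" by simp
      ultimately show ?thesis using 3 True assms by (simp add: power2_eq_square algebra_simps add_divide_distrib diff_divide_distrib)
    next
      case False
      have "0 \<le> t * (\<tau> - 13/20)" using False assms by simp
      moreover have "0 \<le> (1 - \<tau>)\<^sup>2" by simp
      ultimately show ?thesis using 3 False assms by (simp add: power2_eq_square algebra_simps add_divide_distrib diff_divide_distrib)
    qed
    ultimately show ?thesis using ln_5_3 by argo
  next
    case 4
    have "br_G t = 319/1000 * ln (5/3) + 319/600 * ((t - 2/5) + (t - 2/5)\<^sup>2 / 2)"
      "br_G \<tau> = 319/1000 * ln (5/3) + 319/600 * ((\<tau> - 2/5) + (\<tau> - 2/5)\<^sup>2 / 2)"
      using 4 by (simp_all add: br_G_def)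
    moreover have "0 \<le> (t - 2/5)\<^sup>2" "0 \<le> (\<tau> - 2/5)\<^sup>2" by simp_all
    moreover have "0 \<le> (t - 2/5) * (\<tau> - 2/5)" using 4 by simp
    ultimately show ?thesis using ln_5_3 4 assms
      by (simp add: power2_eq_square algebra_simps add_divide_distrib diff_divide_distrib)
  qed
qed

text \<open>Removes \<open>\<theta>\<close> from the problem. Equality holds throughout
  \<open>\<theta> \<le> 2/5\<close>; beyond that the slack is exactly
  \<open>319/600 * ((\<theta> - 2/5) * (\<theta> - t))\<close>.\<close>

lemma br_g_threshold_cost:
  assumes "0 \<le> t" "t \<le> \<theta>" "\<theta> < 1"
  shows "(1 - \<theta>) * br_g \<theta> + t * br_g (max \<theta> (2/5)) \<le> 319/600 * (3/5 + t)"
proof (cases "\<theta> \<le> 2/5")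
  case True
  then have "max \<theta> (2/5) = 2/5" by simp
  moreover have "br_g \<theta> = 319/1000 / (1 - \<theta>)" "br_g (2/5) = 319/600"
    using True by (simp_all add: br_g_def)
  moreover have "(1 - \<theta>) * (319/1000 / (1 - \<theta>)) = 319/1000"
    using assms by (subst times_divide_eq_right, subst nonzero_mult_div_cancel_left) auto
  ultimately have "(1 - \<theta>) * br_g \<theta> + t * br_g (max \<theta> (2/5)) = 319/1000 + t * (319/600)"
    by (simp only:)
  then show ?thesis by argo
next
  case False
  have "0 \<le> 319/600 * ((\<theta> - 2/5) * (\<theta> - t))" using assms False by simp
  then show ?thesis
    using assms False by (simp add: br_g_def max_def algebra_simps add_divide_distrib diff_divide_distrib)
qed

lemma core_ineq:
  assumes "\<tau> \<in> {0..1}" "t \<in> {0..2/5}" "39/1000 \<le> \<phi>" "\<phi> \<le> 77/1000"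
  shows "569/1000 \<le> (\<phi>\<^sup>2 - (39/1000)\<^sup>2) / (19/100) - 76/10000 + br_G \<tau> + 77/1000 * \<tau>
    + br_G t + (1 - \<tau>) * (1 - \<phi> - 319/600 * (3/5 + t)) - (77/1000 - \<phi>) * max 0 (1/10 - \<tau>)"
proof (cases "\<tau> \<le> 2/5")
  case True
  \<comment> \<open>With \<open>r = 3/5\<close> the product of \<open>1 - \<tau>\<close> and
    \<open>1 - t\<close> gets the coefficient \<open>- 319/600\<close>, which cancels the one in the
    remaining terms. Thus \<open>t\<close> drops out.\<close>
  have "319/1000 * (1 + ln (1/(3/5))) - 319/1000 * ((1 - \<tau>) * (1 - t)) / (3/5) \<le> br_G \<tau> + br_G t"
    using assms True by (intro br_G_low) auto
  moreover have "(1 - \<tau>) * (1 - \<phi> - 319/600 * (3/5 + t)) =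
      (1 - \<tau>) * (1 - \<phi> - 319/1000 - 319/600) + 319/1000 * ((1 - \<tau>) * (1 - t)) / (3/5)"
    by (simp add: algebra_simps add_divide_distrib diff_divide_distrib)
  ultimately show ?thesis
    using core_ineq_tau_le[of \<tau> \<phi>] assms True ln_5_3 by simp argo
next
  case False
  have "319/1000 * t \<le> br_G t" using assms by (intro br_G_ge) auto
  moreover have "0 \<le> 319/600 * (t * (\<tau> - 2/5))" using assms False by simp
  moreover have "(1 - \<tau>) * (1 - \<phi> - 319/600 * (3/5 + t)) =
      (1 - \<tau>) * (1 - \<phi> - 319/1000) - 319/1000 * t + 319/600 * (t * (\<tau> - 2/5))"
    by (simp add: algebra_simps add_divide_distrib diff_divide_distrib)
  moreover have "br_G \<tau> = 319/1000 * ln (5/3) + 319/600 * ((\<tau> - 2/5) + (\<tau> - 2/5)\<^sup>2 / 2)"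
    using False by (simp add: br_G_def)
  moreover have "max 0 (1/10 - \<tau>) = 0" using False by simp
  ultimately show ?thesis
    using core_ineq_tau_ge[of \<tau> \<phi>] ln_5_3 assms(1) by simp
qed

lemma main_ineq_lt:
  assumes "\<tau> \<in> {0..1}" "0 \<le> t" "t \<le> \<theta>" "\<theta> < 1" "39/1000 \<le> \<phi>" "\<phi> \<le> 77/1000"
  shows "569/1000 \<le> (\<phi>\<^sup>2 - (39/1000)\<^sup>2) / (19/100) - 76/10000 + (br_G \<tau> + 77/1000 * \<tau> + br_G t
    + (1 - \<tau>) * ((\<theta> - t) * (1 - \<phi>) + (1 - \<theta>) * (1 - br_g \<theta> - \<phi>))
    + t * ((1 - \<tau>) * (1 - br_g (max \<theta> (2/5)) - \<phi>) - (77/1000 - \<phi>) * max 0 (1/10 - \<tau>)))"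
proof -
  define t' where "t' = min t (2/5)"
  let ?X = "(1 - \<theta>) * br_g \<theta> + t * br_g (max \<theta> (2/5))"
  have t': "t' \<in> {0..2/5}" using assms by (auto simp: t'_def)
  have "(1 - \<tau>) * ?X \<le> (1 - \<tau>) * (319/600 * (3/5 + t))"
    using assms br_g_threshold_cost[of t \<theta>] by (intro mult_left_mono) auto
  \<comment> \<open>Values of \<open>t\<close> beyond \<open>2/5\<close> may be lowered to
    \<open>2/5\<close>: there \<open>br_G\<close> has slope at least \<open>319/600\<close>, while
    the cost has slope \<open>319/600\<close> times \<open>1 - \<tau>\<close>.\<close>
  moreover have "br_G t' - (1 - \<tau>) * (319/600 * (3/5 + t')) \<le> br_G t - (1 - \<tau>) * (319/600 * (3/5 + t))"
  proof (cases "t \<le> 2/5")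
    case False
    then have t'': "t' = 2/5" by (simp add: t'_def)
    have "br_G (2/5) + 319/600 * (t - 2/5) \<le> br_G t" using False by (intro br_G_ge_linear) simp
    moreover have "0 \<le> 319/600 * (\<tau> * (t - 2/5))" using assms False by simp
    ultimately show ?thesis unfolding t'' by (simp add: algebra_simps add_divide_distrib diff_divide_distrib)
  qed (simp add: t'_def)
  moreover have "t * ((77/1000 - \<phi>) * max 0 (1/10 - \<tau>)) \<le> 1 * ((77/1000 - \<phi>) * max 0 (1/10 - \<tau>))"
    using assms by (intro mult_right_mono) auto
  moreover have "(1 - \<tau>) * ((\<theta> - t) * (1 - \<phi>) + (1 - \<theta>) * (1 - br_g \<theta> - \<phi>))
    + t * ((1 - \<tau>) * (1 - br_g (max \<theta> (2/5)) - \<phi>) - (77/1000 - \<phi>) * max 0 (1/10 - \<tau>)) =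
    (1 - \<tau>) * (1 - \<phi>) - (1 - \<tau>) * ?X - t * ((77/1000 - \<phi>) * max 0 (1/10 - \<tau>))"
    by algebra
  moreover have "(1 - \<tau>) * (1 - \<phi> - 319/600 * (3/5 + t')) =
    (1 - \<tau>) * (1 - \<phi>) - (1 - \<tau>) * (319/600 * (3/5 + t'))"
    by algebra
  ultimately show ?thesis
    using core_ineq[OF assms(1) t' assms(5,6)] by argo
qed

lemma main_ineq_one:
  assumes "\<tau> \<in> {0..1}" "t \<in> {0..1}" "39/1000 \<le> \<phi>" "\<phi> \<le> 77/1000"
  shows "569/1000 \<le> (\<phi>\<^sup>2 - (39/1000)\<^sup>2) / (19/100) - 76/10000 + (br_G \<tau> + 77/1000 * \<tau> + br_G t
    + (1 - \<tau>) * ((1 - t) * (1 - \<phi>)))"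
proof -
  have "(39/1000)\<^sup>2 \<le> \<phi>\<^sup>2" using assms by (intro power_mono) auto
  then have "0 \<le> (\<phi>\<^sup>2 - (39/1000)\<^sup>2) / (19/100)" by simp
  moreover have "(1 - \<tau>) * ((1 - t) * (923/1000)) \<le> (1 - \<tau>) * ((1 - t) * (1 - \<phi>))"
    using assms by (intro mult_left_mono) auto
  moreover have "923/1000 * ((1 - \<tau>) * (1 - t)) = (1 - \<tau>) * ((1 - t) * (923/1000))"
    by simp
  ultimately show ?thesis
    using core_ineq_one[OF assms(1,2)] by linarith
qed

section \<open>Greedy matching at deadlines\<close>

text \<open>\<open>dl k\<close> is the vertex whose deadline is step \<open>k\<close>, if any, and \<open>c k v\<close> is the number used for \<open>v\<close>
  in that step. Ties are broken by vertex number, so that the comparisons below hold for all ranks.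
  The parameter \<open>X\<close> of \<open>matched\<close> is the initially matched set: it removes the vertices of \<open>X\<close> from
  the graph.\<close>

locale greedy_process =
  fixes dl :: "nat \<Rightarrow> nat option" and nb :: "nat \<Rightarrow> nat set"
    and c :: "nat \<Rightarrow> nat \<Rightarrow> real" and g :: "real \<Rightarrow> real"
  assumes finite_nb [simp]: "finite (nb u)"
begin

definition better :: "nat \<Rightarrow> (nat \<Rightarrow> real) \<Rightarrow> nat \<Rightarrow> nat \<Rightarrow> bool" where
  "better k y v w \<longleftrightarrow> g (y v) + c k v < g (y w) + c k w \<or> g (y v) + c k v = g (y w) + c k w \<and> v < w"

definition sel :: "nat \<Rightarrow> (nat \<Rightarrow> real) \<Rightarrow> nat set \<Rightarrow> nat \<Rightarrow> nat \<Rightarrow> bool" where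
  "sel k y S u w \<longleftrightarrow> w \<in> nb u - S \<and> (\<forall>w'\<in>nb u - S. w' \<noteq> w \<longrightarrow> better k y w w')"

primrec matched :: "nat set \<Rightarrow> (nat \<Rightarrow> real) \<Rightarrow> nat \<Rightarrow> nat set" where
  "matched X y 0 = X"
| "matched X y (Suc k) = matched X y k \<union>
     {x. \<exists>u w. dl k = Some u \<and> u \<notin> matched X y k \<and> sel k y (matched X y k) u w \<and> (x = u \<or> x = w)}"

lemma sel_unique: "sel k y S u w \<Longrightarrow> sel k y S u w' \<Longrightarrow> w = w'"
  unfolding sel_def better_def by force

lemma sel_antimono: "sel k y S u w \<Longrightarrow> S \<subseteq> S' \<Longrightarrow> w \<notin> S' \<Longrightarrow> sel k y S' u w"
  unfolding sel_def by blast

lemma sel_cong: "(\<And>w. w \<in> nb u - S \<Longrightarrow> y w = y' w) \<Longrightarrow> sel k y S u w = sel k y' S u w"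
  unfolding sel_def better_def by (intro conj_cong ball_cong refl) auto

lemma sel_key_le: "sel k y S u w \<Longrightarrow> z \<in> nb u - S \<Longrightarrow> g (y w) + c k w \<le> g (y z) + c k z"
  unfolding sel_def better_def by force

lemma sel_exists:
  assumes "nb u - S \<noteq> {}"
  obtains w where "sel k y S u w"
proof -
  define key where "key w = g (y w) + c k w" for w
  let ?N = "nb u - S"
  define W where "W = {w \<in> ?N. key w = Min (key ` ?N)}"
  have fin: "finite ?N" "finite W" using assms by (auto simp: W_def)
  have "Min (key ` ?N) \<in> key ` ?N" using assms fin by (intro Min_in) auto
  then have "W \<noteq> {}" by (auto simp: W_def)
  then have m: "Min W \<in> W" using fin by (intro Min_in) auto
  have "better k y (Min W) w'" if "w' \<in> ?N" "w' \<noteq> Min W" for w'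
  proof -
    have "key (Min W) \<le> key w'" using m that fin by (auto simp: W_def)
    moreover have "Min W < w'" if "key w' = key (Min W)"
    proof -
      have "w' \<in> W" using that m \<open>w' \<in> ?N\<close> by (simp add: W_def)
      then have "Min W \<le> w'" using fin by (intro Min_le)
      then show ?thesis using \<open>w' \<noteq> Min W\<close> by simp
    qed
    ultimately show ?thesis unfolding better_def key_def by (metis order_le_less)
  qed
  with m show ?thesis by (intro that[of "Min W"]) (auto simp: sel_def W_def)
qed

lemma matched_mono: "j \<le> k \<Longrightarrow> matched X y j \<subseteq> matched X y k"
  by (rule lift_Suc_mono_le[of "matched X y"]) auto

lemma subset_matched: "X \<subseteq> matched X y k"
  using matched_mono[of 0 k X y] by simp

lemma matched_cong:
  assumes "\<And>w. w \<notin> X \<Longrightarrow> y w = y' w"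
  shows "matched X y k = matched X y' k"
proof (induction k)
  case (Suc k)
  have "sel k y (matched X y' k) u w = sel k y' (matched X y' k) u w" for u w
    using assms subset_matched[of X y' k] by (intro sel_cong) blast
  then show ?case by (simp add: Suc)
qed simp

text \<open>A vertex that stays free is never selected, and if its own deadline occurs, it has no
  free neighbour to take. Deleting it therefore changes no step: the best choice of every other
  active vertex was already different from \<open>v\<close>.\<close>

lemma matched_insert:
  assumes "v \<notin> matched X y k"
  shows "matched (insert v X) y k = insert v (matched X y k)"
  using assms
proof (induction k)
  case (Suc k)
  let ?S = "matched X y k"
  from Suc have IH: "matched (insert v X) y k = insert v ?S" by simp
  have v: "v \<notin> ?S" using Suc by simp
  have *: "(u \<notin> insert v ?S \<and> sel k y (insert v ?S) u w) = (u \<notin> ?S \<and> sel k y ?S u w)"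
    if u: "dl k = Some u" for u w
  proof
    assume a: "u \<notin> ?S \<and> sel k y ?S u w"
    then have "u \<noteq> v" "w \<noteq> v" using Suc.prems u by auto
    with a show "u \<notin> insert v ?S \<and> sel k y (insert v ?S) u w"
      by (auto intro: sel_antimono simp: sel_def)
  next
    assume a: "u \<notin> insert v ?S \<and> sel k y (insert v ?S) u w"
    then obtain w' where w': "sel k y ?S u w'" using sel_exists[of u ?S k y]
      by (metis Diff_iff empty_iff insert_iff sel_def)
    then have "w' \<noteq> v" using Suc.prems u a by auto
    then have "sel k y (insert v ?S) u w'" using w' by (intro sel_antimono[OF w']) (auto simp: sel_def)
    then show "u \<notin> ?S \<and> sel k y ?S u w" using a sel_unique w' by blast
  qed
  show ?case using * IH by auto
qed simp

text \<open>While \<open>v\<close> stays free it never wins a comparison, and a larger rank only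
  makes it lose more clearly. So the two runs coincide step by step, which makes being matched a
  threshold property of the rank.\<close>

lemma not_matched_rank_mono:
  assumes "v \<notin> matched X (y(v := b)) k" "mono_on {0..1} g" "b \<in> {0..1}" "b' \<in> {0..1}" "b \<le> b'"
  shows "v \<notin> matched X (y(v := b')) k"
proof -
  let ?y = "y(v := b)" and ?y' = "y(v := b')"
  have gb: "g b \<le> g b'" using assms by (intro mono_onD[OF assms(2)]) auto
  have "matched X ?y' j = matched X ?y j" if "j \<le> k" for j
    using that
  proof (induction j)
    case (Suc j)
    let ?S = "matched X ?y j"
    have eq: "matched X ?y' j = ?S" by (rule Suc.IH) (use Suc.prems in simp)
    have v: "v \<notin> matched X ?y (Suc j)" using assms(1) matched_mono[OF Suc.prems] by blast
    have "sel j ?y' ?S u w = sel j ?y ?S u w" if u: "dl j = Some u" "u \<notin> ?S" for u w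
    proof -
      have *: "sel j ?y' ?S u w" if "sel j ?y ?S u w" for w
      proof -
        have "w \<noteq> v" using v u that by auto
        then show ?thesis using that gb unfolding sel_def better_def
          by (smt (verit, ccfv_SIG) fun_upd_apply)
      qed
      moreover have "sel j ?y ?S u w" if "sel j ?y' ?S u w" for w
      proof -
        from that have "nb u - ?S \<noteq> {}" by (auto simp: sel_def)
        then obtain w' where w': "sel j ?y ?S u w'" by (rule sel_exists)
        then show ?thesis using * that sel_unique by blast
      qed
      ultimately show ?thesis by blast
    qed
    then show ?case unfolding matched.simps eq by blast
  qed simp
  then show ?thesis using assms(1) by (metis order_refl)
qed

text \<open>Consider the first step that would match \<open>u\<close> or \<open>v\<close>. Neither
  is active, so some other vertex selects one of them. Up to then the runs with one of the two
  deleted agree with the full run, and in the run without the other vertex the selected one would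
  still be the best choice, hence matched there.\<close>

lemma not_matched_of_not_matched:
  assumes "u \<notin> matched {v} y k" "v \<notin> matched {u} y k"
    and "\<And>j. j < k \<Longrightarrow> dl j \<noteq> Some u" "\<And>j. j < k \<Longrightarrow> dl j \<noteq> Some v"
  shows "u \<notin> matched {} y k \<and> v \<notin> matched {} y k"
  using assms
proof (induction k)
  case 0
  then show ?case by simp
next
  case (Suc k)
  let ?S = "matched {} y k"
  have "u \<notin> ?S" "v \<notin> ?S" using Suc by auto
  then have eq: "matched {v} y k = insert v ?S" "matched {u} y k = insert u ?S"
    by (simp_all add: matched_insert)
  have uv: "u \<noteq> v" using Suc.prems subset_matched[of "{v}"] by blast
  have no: False if "dl k = Some x" "x \<notin> ?S" "sel k y ?S x w" "w = u \<or> w = v" for x w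
  proof -
    have x: "x \<noteq> u" "x \<noteq> v" using that Suc.prems(3,4)[of k] by auto
    show False
    proof (cases "w = u")
      case True
      have "sel k y (insert v ?S) x u"
        by (rule sel_antimono[OF that(3)[unfolded True]]) (use uv \<open>u \<notin> ?S\<close> in auto)
      then have "u \<in> matched {v} y (Suc k)"
        unfolding matched.simps eq using \<open>dl k = Some x\<close> x(2) \<open>x \<notin> ?S\<close> by blast
      then show False using Suc.prems by blast
    next
      case False
      then have w: "w = v" using that(4) by simp
      have "sel k y (insert u ?S) x v"
        by (rule sel_antimono[OF that(3)[unfolded w]]) (use uv \<open>v \<notin> ?S\<close> in auto)
      then have "v \<in> matched {u} y (Suc k)"
        unfolding matched.simps eq using \<open>dl k = Some x\<close> x(1) \<open>x \<notin> ?S\<close> by blast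
      then show False using Suc.prems by blast
    qed
  qed
  have "x \<notin> matched {} y (Suc k)" if x: "x = u \<or> x = v" for x
  proof
    assume "x \<in> matched {} y (Suc k)"
    moreover have "x \<notin> ?S" "dl k \<noteq> Some x" using x \<open>u \<notin> ?S\<close> \<open>v \<notin> ?S\<close> Suc.prems(3,4)[of k] by auto
    ultimately obtain x' where "dl k = Some x'" "x' \<notin> ?S" "sel k y ?S x' x" by auto
    then show False using no x by blast
  qed
  then show ?case by blast
qed

end

locale bipartite_greedy_process = greedy_process +
  fixes L R :: "nat set"
  assumes LR_disjoint: "L \<inter> R = {}"
    and nb_L: "u \<in> L \<Longrightarrow> nb u \<subseteq> R" and nb_R: "u \<in> R \<Longrightarrow> nb u \<subseteq> L"
    and nb_empty: "u \<notin> L \<union> R \<Longrightarrow> nb u = {}"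
begin

text \<open>This one-sided comparison replaces the usual alternating path argument.\<close>

lemma matched_opposite_sides:
  assumes "X \<inter> R \<subseteq> Y \<inter> R" "Y \<inter> L \<subseteq> X \<inter> L"
  shows "matched X y k \<inter> R \<subseteq> matched Y y k \<inter> R \<and> matched Y y k \<inter> L \<subseteq> matched X y k \<inter> L"
proof (induction k)
  case 0
  then show ?case using assms by simp
next
  case (Suc k)
  let ?A = "matched X y k" and ?B = "matched Y y k"
  let ?A' = "matched X y (Suc k)" and ?B' = "matched Y y (Suc k)"
  have R: "?A \<inter> R \<subseteq> ?B" and L: "?B \<inter> L \<subseteq> ?A" using Suc by auto
  show ?case
  proof (cases "dl k")
    case None
    then show ?thesis using Suc by simp
  next
    case (Some u)
    have step: "matched Z y (Suc k) = matched Z y k \<union>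
        {x. \<exists>w. u \<notin> matched Z y k \<and> sel k y (matched Z y k) u w \<and> (x = u \<or> x = w)}" for Z
      using Some by auto
    consider "u \<in> L" | "u \<in> R" | "u \<notin> L \<union> R" by blast
    then show ?thesis
    proof cases
      case 1
      then have N: "nb u \<subseteq> R" "u \<notin> R" using nb_L LR_disjoint by auto
      then have sub: "nb u - ?B \<subseteq> nb u - ?A" using R by blast
      \<comment> \<open>The vertex \<open>u\<close> has fewer free neighbours in the run from
        \<open>Y\<close>. If \<open>a\<close> is among them, it remains the best choice there; if
        not, it is already matched.\<close>
      have "a \<in> ?B'" if "u \<notin> ?A" "sel k y ?A u a" for a
      proof (rule ccontr)
        assume a: "a \<notin> ?B'"
        then have "a \<notin> ?B" using matched_mono[of k "Suc k" Y y] by auto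
        with that N sub have "sel k y ?B u a" unfolding sel_def by blast
        moreover have "u \<notin> ?B" using that 1 L by blast
        ultimately have "a \<in> ?B'" unfolding step[of Y] by blast
        then show False using a by simp
      qed
      then have "?A' \<inter> R \<subseteq> ?B'" unfolding step[of X] using R N matched_mono[of k "Suc k" Y y] by auto
      moreover have "u \<in> ?A'" if b: "u \<notin> ?B" "sel k y ?B u b" for b
      proof (cases "u \<in> ?A")
        case False
        from b sub have "nb u - ?A \<noteq> {}" unfolding sel_def by blast
        then obtain a where "sel k y ?A u a" by (rule sel_exists)
        then show ?thesis unfolding step[of X] using False by blast
      qed (unfold step[of X], blast)
      then have "?B' \<inter> L \<subseteq> ?A'" unfolding step[of Y]
        using L N LR_disjoint matched_mono[of k "Suc k" X y] by (auto simp: sel_def)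
      ultimately show ?thesis by blast
    next
      case 2
      then have N: "nb u \<subseteq> L" "u \<notin> L" using nb_R LR_disjoint by auto
      then have sub: "nb u - ?A \<subseteq> nb u - ?B" using L by blast
      have "b \<in> ?A'" if "u \<notin> ?B" "sel k y ?B u b" for b
      proof (rule ccontr)
        assume b: "b \<notin> ?A'"
        then have "b \<notin> ?A" using matched_mono[of k "Suc k" X y] by auto
        with that N sub have "sel k y ?A u b" unfolding sel_def by blast
        moreover have "u \<notin> ?A" using that 2 R by blast
        ultimately have "b \<in> ?A'" unfolding step[of X] by blast
        then show False using b by simp
      qed
      then have "?B' \<inter> L \<subseteq> ?A'" unfolding step[of Y] using L N matched_mono[of k "Suc k" X y] by auto
      moreover have "u \<in> ?B'" if a: "u \<notin> ?A" "sel k y ?A u a" for a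
      proof (cases "u \<in> ?B")
        case False
        from a sub have "nb u - ?B \<noteq> {}" unfolding sel_def by blast
        then obtain b where "sel k y ?B u b" by (rule sel_exists)
        then show ?thesis unfolding step[of Y] using False by blast
      qed (unfold step[of Y], blast)
      then have "?A' \<inter> R \<subseteq> ?B'" unfolding step[of X]
        using R N LR_disjoint matched_mono[of k "Suc k" Y y] by (auto simp: sel_def)
      ultimately show ?thesis by blast
    next
      case 3
      then show ?thesis unfolding step[of X] step[of Y] sel_def using Suc nb_empty by auto
    qed
  qed
qed

end

section \<open>The gain of an edge for fixed other ranks\<close>

text \<open>Nothing is claimed at \<open>t\<close> itself, since a single rank has probability zero.
  The lower end \<open>l\<close> allows a threshold to be placed at or above an earlier one.\<close>

lemma threshold_exists:
  fixes P :: "real \<Rightarrow> bool"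
  assumes "\<And>a b. 0 \<le> a \<Longrightarrow> a \<le> b \<Longrightarrow> b \<le> 1 \<Longrightarrow> P b \<Longrightarrow> P a" and "0 \<le> l" "l \<le> 1"
    and "\<And>a. 0 \<le> a \<Longrightarrow> a < l \<Longrightarrow> P a"
  obtains t where "l \<le> t" "t \<le> 1" "\<And>a. 0 \<le> a \<Longrightarrow> a < t \<Longrightarrow> P a" "\<And>a. t < a \<Longrightarrow> a \<le> 1 \<Longrightarrow> \<not> P a"
proof -
  define A where "A = insert l {a \<in> {0..1}. P a}"
  have bdd: "bdd_above A" using assms(3) by (auto simp: A_def intro!: bdd_aboveI[of _ 1])
  have "A \<noteq> {}" by (auto simp: A_def)
  show ?thesis
  proof (rule that[of "Sup A"])
    show "l \<le> Sup A" by (rule cSup_upper[OF _ bdd]) (simp add: A_def)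
    show "Sup A \<le> 1" using \<open>A \<noteq> {}\<close> by (rule cSup_least) (use assms(3) in \<open>auto simp: A_def\<close>)
    show "P a" if a: "0 \<le> a" "a < Sup A" for a
    proof -
      obtain b where "b \<in> A" "a < b" using less_cSup_iff[OF \<open>A \<noteq> {}\<close> bdd] a by blast
      then show ?thesis using assms(1)[of a b] assms(4)[of a] a by (auto simp: A_def)
    qed
    show "\<not> P a" if a: "Sup A < a" "a \<le> 1" for a
    proof
      assume "P a"
      have "0 \<le> a" using cSup_upper[OF _ bdd, of l] assms(2) a by (auto simp: A_def)
      then have "a \<in> A" using \<open>P a\<close> a by (simp add: A_def)
      then show False using cSup_upper[OF _ bdd, of a] a by simp
    qed
  qed
qed

text \<open>\<open>A\<close> is what \<open>u\<close> can secure from a neighbour other than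
  \<open>v\<close>. In the branch with the minimum, \<open>u\<close> would be free without
  \<open>v\<close>, but the presence of \<open>v\<close> may have led to a passive match of
  \<open>u\<close>, so the worse income counts. The value \<open>1 - \<phi>\<close> arises when
  \<open>u\<close> takes \<open>v\<close>: the two rank parts \<open>g b\<close> cancel.\<close>

definition pair_bound :: "(real \<Rightarrow> real) \<Rightarrow> real \<Rightarrow> real \<Rightarrow> real \<Rightarrow> real \<Rightarrow> real \<Rightarrow> real \<Rightarrow> real \<Rightarrow> real" where
  "pair_bound g m \<phi> \<tau> t \<theta> a b =
    (let A = if \<theta> < 1 then 1 - g \<theta> - \<phi> else 0 in
     if a < \<tau> then g a + m + (if b < t then g b else 0)
     else if b < t then g b + min (g a + m) A
     else if b < \<theta> then 1 - \<phi> else A)"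

context bipartite_greedy_process
begin

definition active_gain :: "nat \<Rightarrow> nat \<Rightarrow> (nat \<Rightarrow> real) \<Rightarrow> real" where
  "active_gain u d y = (\<Sum>w\<in>nb u. if u \<notin> matched {} y d \<and> sel d y (matched {} y d) u w then 1 - g (y w) - c d w else 0)"

text \<open>The gain of the edge without the \<open>f\<close>-part of passive gains; instead \<open>m\<close>, the slope of the tangent
  to \<open>F\<close>, is credited whenever \<open>u\<close> is matched passively.\<close>

definition pair_gain :: "real \<Rightarrow> nat \<Rightarrow> nat \<Rightarrow> nat \<Rightarrow> (nat \<Rightarrow> real) \<Rightarrow> real" where
  "pair_gain m u v d y = (if u \<in> matched {} y d then g (y u) + m else 0)
    + (if v \<in> matched {} y (Suc d) then g (y v) else 0) + active_gain u d y"

lemma active_gain_eq: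
  assumes "u \<notin> matched {} y d" "sel d y (matched {} y d) u w"
  shows "active_gain u d y = 1 - g (y w) - c d w"
proof -
  have "active_gain u d y = (\<Sum>w'\<in>nb u. if w' = w then 1 - g (y w') - c d w' else 0)"
    unfolding active_gain_def using assms sel_unique by (intro sum.cong) auto
  also have "\<dots> = 1 - g (y w) - c d w" using assms by (subst sum.delta) (auto simp: sel_def)
  finally show ?thesis .
qed

lemma active_gain_nonneg:
  assumes "\<And>w. w \<in> nb u \<Longrightarrow> g (y w) + c d w \<le> 1"
  shows "0 \<le> active_gain u d y"
  unfolding active_gain_def using assms by (intro sum_nonneg) (auto simp: algebra_simps)

lemma active_gain_ge:
  assumes "u \<notin> matched {} y d" "z \<in> nb u - matched {} y d"
  shows "1 - (g (y z) + c d z) \<le> active_gain u d y"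
proof -
  obtain w where w: "sel d y (matched {} y d) u w" using assms(2) sel_exists by blast
  then show ?thesis using active_gain_eq[OF assms(1) w] sel_key_le[OF w assms(2)] by simp
qed

lemma pair_gain_ge_pair_bound:
  assumes g: "mono_on {0..1} g" "continuous_on {0..1} g" "\<And>r. r \<in> {0..1} \<Longrightarrow> 0 \<le> g r"
    and c: "\<And>w r. w \<in> nb u \<Longrightarrow> r \<in> {0..1} \<Longrightarrow> g r + c d w \<le> 1"
    and uL: "u \<in> L" and v: "v \<in> nb u"
    and dl: "dl d = Some u" "\<And>j. j < d \<Longrightarrow> dl j \<noteq> Some u" "\<And>j. j \<le> d \<Longrightarrow> dl j \<noteq> Some v"
    and y: "\<And>w. y w \<in> {0..1}" and m: "0 \<le> m"
  obtains \<tau> t \<theta> where "0 \<le> \<tau>" "\<tau> \<le> 1" "0 \<le> t" "t \<le> \<theta>" "\<theta> \<le> 1"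
    "\<And>a b. a \<in> {0..1} \<Longrightarrow> b \<in> {0..1} \<Longrightarrow> a \<noteq> \<tau> \<Longrightarrow> b \<noteq> t \<Longrightarrow> b \<noteq> \<theta> \<Longrightarrow>
      pair_bound g m (c d v) \<tau> t \<theta> a b \<le> pair_gain m u v d (y(u := a, v := b))"
proof -
  have vR: "v \<in> R" "u \<notin> R" "v \<notin> L" "u \<noteq> v" using nb_L[OF uL] v uL LR_disjoint by auto
  let ?Y = "\<lambda>a b. y(u := a, v := b)"
  have Y01: "?Y a b w \<in> {0..1}" if "a \<in> {0..1}" "b \<in> {0..1}" for a b w
    using that y by auto
  obtain \<tau> where \<tau>: "0 \<le> \<tau>" "\<tau> \<le> 1"
    and \<tau>1: "\<And>a. 0 \<le> a \<Longrightarrow> a < \<tau> \<Longrightarrow> u \<in> matched {v} (y(u := a)) d"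
    and \<tau>2: "\<And>a. \<tau> < a \<Longrightarrow> a \<le> 1 \<Longrightarrow> u \<notin> matched {v} (y(u := a)) d"
    by (rule threshold_exists[of "\<lambda>a. u \<in> matched {v} (y(u := a)) d" 0])
      (use not_matched_rank_mono[OF _ g(1), of u "{v}" y _ d] in auto)
  define Pb where "Pb b \<longleftrightarrow> v \<in> matched {u} (y(v := b)) d" for b
  have Pb_mono: "Pb a" if "0 \<le> a" "a \<le> b" "b \<le> 1" "Pb b" for a b
    using not_matched_rank_mono[OF _ g(1), of v "{u}" y a d b] that by (auto simp: Pb_def)
  obtain t where t: "0 \<le> t" "t \<le> 1"
    and t1: "\<And>b. 0 \<le> b \<Longrightarrow> b < t \<Longrightarrow> Pb b" and t2: "\<And>b. t < b \<Longrightarrow> b \<le> 1 \<Longrightarrow> \<not> Pb b"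
    by (rule threshold_exists[of Pb 0]) (use Pb_mono in auto)
  \<comment> \<open>With both endpoints deleted, the outcome is independent of the ranks
    \<open>a\<close> and \<open>b\<close>; \<open>nb u - S\<close> are the alternatives to
    \<open>v\<close>.\<close>
  define S where "S = matched {u, v} y d"
  have uvS: "u \<in> S" "v \<in> S" unfolding S_def using subset_matched by blast+
  \<comment> \<open>The first disjunct enforces \<open>t \<le> \<theta>\<close> even if
    \<open>v\<close> never beats the alternatives.\<close>
  define Pc where "Pc b \<longleftrightarrow> b < t \<or> (\<forall>z\<in>nb u - S. g b + c d v < g (y z) + c d z)" for b
  obtain \<theta> where \<theta>: "t \<le> \<theta>" "\<theta> \<le> 1"
    and \<theta>1: "\<And>b. 0 \<le> b \<Longrightarrow> b < \<theta> \<Longrightarrow> Pc b" and \<theta>2: "\<And>b. \<theta> < b \<Longrightarrow> b \<le> 1 \<Longrightarrow> \<not> Pc b"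
  proof (rule threshold_exists[of Pc t])
    show "Pc a" if "0 \<le> a" "a \<le> b" "b \<le> 1" "Pc b" for a b
    proof -
      have "g a \<le> g b" using that by (intro mono_onD[OF g(1)]) auto
      then show ?thesis using that by (force simp: Pc_def)
    qed
  qed (use t in \<open>auto simp: Pc_def\<close>)
  \<comment> \<open>For \<open>\<theta> = 1\<close> there may be no neighbour of \<open>u\<close> other than \<open>v\<close>, hence the case distinction.\<close>
  define A where "A = (if \<theta> < 1 then 1 - g \<theta> - c d v else 0)"
  have A_le: "\<exists>z\<in>nb u - S. A \<le> 1 - (g (y z) + c d z)" if "\<theta> < 1"
  proof -
    have fin: "finite (nb u - S)" by simp
    have ex: "\<exists>z\<in>nb u - S. g (y z) + c d z \<le> g b + c d v" if "\<theta> < b" "b \<le> 1" for b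
      using \<theta>2[OF that] by (auto simp: Pc_def not_less)
    define \<beta> where "\<beta> = Min ((\<lambda>z. g (y z) + c d z) ` (nb u - S))"
    have ne: "nb u - S \<noteq> {}" using ex[of 1] \<open>\<theta> < 1\<close> by auto
    have le: "\<beta> - c d v \<le> g b" if b: "b \<in> {\<theta><..<1}" for b
    proof -
      obtain z where z: "z \<in> nb u - S" "g (y z) + c d z \<le> g b + c d v" using ex[of b] b by auto
      then have "\<beta> \<le> g (y z) + c d z" unfolding \<beta>_def using fin by (intro Min_le) auto
      with z show ?thesis by simp
    qed
    \<comment> \<open>The alternatives beat \<open>v\<close> only for ranks strictly above
      \<open>\<theta>\<close>; continuity of \<open>g\<close> carries the estimate to
      \<open>\<theta>\<close> itself. Taking the minimum over the finitely many alternatives makes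
      the bound uniform in the rank.\<close>
    have "\<beta> - c d v \<le> g \<theta>"
    proof (rule continuous_ge_on_closure[of "{\<theta><..<1}" g])
      show "continuous_on (closure {\<theta><..<1}) g"
        using g(2) by (rule continuous_on_subset) (use \<theta> t \<open>\<theta> < 1\<close> in auto)
      show "\<theta> \<in> closure {\<theta><..<1}" using \<open>\<theta> < 1\<close> by simp
    qed (use le in auto)
    moreover from fin ne have "\<beta> \<in> (\<lambda>z. g (y z) + c d z) ` (nb u - S)"
      unfolding \<beta>_def by (intro Min_in) auto
    then obtain z where "z \<in> nb u - S" "\<beta> = g (y z) + c d z" by blast
    ultimately show ?thesis using \<open>\<theta> < 1\<close> by (intro bexI[of _ z]) (auto simp: A_def)
  qed
  have main: "pair_bound g m (c d v) \<tau> t \<theta> a b \<le> pair_gain m u v d (?Y a b)"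
    if ab: "a \<in> {0..1}" "b \<in> {0..1}" "a \<noteq> \<tau>" "b \<noteq> t" "b \<noteq> \<theta>" for a b
  proof -
    let ?M = "matched {} (?Y a b) d"
    have Yu: "?Y a b u = a" and Yv: "?Y a b v = b" and Yz: "\<And>z. z \<notin> S \<Longrightarrow> ?Y a b z = y z"
      using vR uvS by auto
    have eqv: "matched {v} (?Y a b) d = matched {v} (y(u := a)) d"
      by (rule matched_cong) (use vR in auto)
    have equ: "matched {u} (?Y a b) d = matched {u} (y(v := b)) d"
      by (rule matched_cong) (use vR in auto)
    have equv: "matched {u, v} (?Y a b) d = S"
      unfolding S_def by (rule matched_cong) (use vR in auto)
    have opp_v: "?M \<inter> R \<subseteq> matched {v} (?Y a b) d \<inter> R" "matched {v} (?Y a b) d \<inter> L \<subseteq> ?M \<inter> L"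
      using matched_opposite_sides[of "{}" "{v}"] vR by auto
    have opp_u: "matched {u} (?Y a b) d \<inter> R \<subseteq> ?M \<inter> R"
      using matched_opposite_sides[of "{u}" "{}"] vR by auto
    have act0: "0 \<le> active_gain u d (?Y a b)"
      using c Y01 ab by (intro active_gain_nonneg) auto
    have g0: "0 \<le> g a" "0 \<le> g b" using g(3) ab by auto
    have v_in: "v \<in> matched {} (?Y a b) (Suc d)" if "b < t"
    proof -
      have "v \<in> matched {u} (?Y a b) d" using t1[of b] that ab unfolding equ Pb_def by auto
      then have "v \<in> ?M" using opp_u vR by auto
      then show ?thesis by simp
    qed
    show ?thesis
    proof (cases "a < \<tau>")
      case True
      then have "u \<in> matched {v} (?Y a b) d" using \<tau>1 ab unfolding eqv by auto
      then have "u \<in> ?M" using opp_v uL by auto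
      then show ?thesis using True act0 g0 v_in Yu Yv m unfolding pair_bound_def pair_gain_def Let_def
        by auto
    next
      case False
      then have "\<tau> < a" using ab by simp
      then have nu: "u \<notin> matched {v} (?Y a b) d" using \<tau>2 ab unfolding eqv by auto
      then have S_eq: "S = insert u (matched {v} (?Y a b) d)"
        using matched_insert[OF nu] equv by (simp add: insert_commute)
      show ?thesis
      proof (cases "b < t")
        case True
        have "min (g a + m) A \<le> (if u \<in> ?M then g a + m else 0) + active_gain u d (?Y a b)"
        proof (cases "u \<in> ?M")
          case False
          have "A \<le> active_gain u d (?Y a b)"
          proof (cases "\<theta> < 1")
            case True
            then obtain z where z: "z \<in> nb u - S" "A \<le> 1 - (g (y z) + c d z)" using A_le by blast
            then have "z \<in> R" "z \<notin> matched {v} (?Y a b) d" using nb_L[OF uL] S_eq by auto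
            \<comment> \<open>Putting \<open>v\<close> back cannot cause any further vertex on the
              side of \<open>v\<close> to be matched, so the alternative \<open>z\<close> is still
              available.\<close>
            then have "z \<in> nb u - ?M" using opp_v z by blast
            then show ?thesis using active_gain_ge[OF False, of z] z Yz[of z] by simp
          qed (use act0 in \<open>simp add: A_def\<close>)
          then show ?thesis using False by simp
        qed (use act0 in simp)
        moreover have "pair_bound g m (c d v) \<tau> t \<theta> a b = g b + min (g a + m) A"
          using False True by (simp add: pair_bound_def A_def)
        moreover have "pair_gain m u v d (?Y a b) = (if u \<in> ?M then g a + m else 0) + g b
            + active_gain u d (?Y a b)"
          unfolding pair_gain_def Yu Yv using v_in[OF True] by (simp only: if_True)
        ultimately show ?thesis by linarith
      next
        case nbt: False
        then have "t < b" using ab by simp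
        then have nv: "v \<notin> matched {u} (?Y a b) d" using t2 ab unfolding equ Pb_def by auto
        \<comment> \<open>Both endpoints are free in the full run as well, so deleting them changed
          nothing else: \<open>u\<close> chooses among \<open>v\<close> and the
          alternatives.\<close>
        have nuv: "u \<notin> ?M" "v \<notin> ?M"
          using not_matched_of_not_matched[OF nu nv] dl by auto
        then have "S = insert u (insert v ?M)" unfolding S_eq by (simp add: matched_insert)
        then have N: "nb u - ?M = insert v (nb u - S)" using nuv v nb_L[OF uL] vR by auto
        show ?thesis
        proof (cases "b < \<theta>")
          case True
          have "sel d (?Y a b) ?M u v"
            unfolding sel_def N
          proof (intro conjI ballI impI)
            fix w assume w: "w \<in> insert v (nb u - S)" "w \<noteq> v"
            then have "g b + c d v < g (y w) + c d w" using \<theta>1[of b] True nbt ab by (auto simp: Pc_def)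
            then show "better d (?Y a b) v w" using w Yz[of w] Yv by (simp add: better_def)
          qed simp
          then have "active_gain u d (?Y a b) = 1 - g b - c d v" "v \<in> matched {} (?Y a b) (Suc d)"
            using active_gain_eq[OF nuv(1)] Yv nuv dl by auto
          then show ?thesis using False nbt True nuv Yv unfolding pair_bound_def pair_gain_def Let_def
            by simp
        next
          case False
          then have "\<theta> < 1" using ab by auto
          then obtain z where z: "z \<in> nb u - S" "A \<le> 1 - (g (y z) + c d z)" using A_le by blast
          then have "A \<le> active_gain u d (?Y a b)"
            using active_gain_ge[OF nuv(1), of z] N Yz[of z] by simp
          moreover have "pair_bound g m (c d v) \<tau> t \<theta> a b = A"
            using \<open>\<not> a < \<tau>\<close> nbt False by (simp add: pair_bound_def A_def)
          moreover have "active_gain u d (?Y a b) \<le> pair_gain m u v d (?Y a b)"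
            unfolding pair_gain_def Yu Yv using g0 m by simp
          ultimately show ?thesis by linarith
        qed
      qed
    qed
  qed
  show ?thesis by (rule that[OF \<tau> t(1) \<theta> main])
qed

end

section \<open>Resampling ranks\<close>

definition unit_measure :: "real measure" where
  "unit_measure = restrict_space lborel {0..1}"

lemma space_unit_measure [simp]: "space unit_measure = {0..1}"
  by (simp add: unit_measure_def space_restrict_space)

interpretation unit_measure: prob_space unit_measure
  by (rule prob_spaceI) (simp add: unit_measure_def emeasure_restrict_space space_restrict_space)

lemma rank_space_eq: "rank_space = (\<Pi>\<^sub>M v\<in>UNIV. unit_measure)"
  by (simp add: rank_space_def unit_measure_def)

lemma space_rank_space: "space rank_space = {y. \<forall>v. y v \<in> {0..1}}"
  by (auto simp: rank_space_eq space_PiM)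

interpretation rank_space: prob_space rank_space
  unfolding rank_space_eq by (rule prob_space_PiM) (rule unit_measure.prob_space_axioms)

lemma measurable_rank [measurable]: "(\<lambda>y. y v) \<in> rank_space \<rightarrow>\<^sub>M unit_measure"
  unfolding rank_space_eq by measurable

lemma borel_measurable_continuous_unit:
  assumes "continuous_on {0..1} g"
  shows "(g :: real \<Rightarrow> real) \<in> borel_measurable unit_measure"
proof -
  have "g \<in> borel_measurable (restrict_space borel {0..1})"
    using assms by (rule borel_measurable_continuous_on_restrict)
  then show ?thesis unfolding unit_measure_def
    by (simp add: measurable_def space_restrict_space sets_restrict_space)
qed

lemma rank_space_resample:
  "distr (unit_measure \<Otimes>\<^sub>M rank_space) rank_space (\<lambda>(a, y). y(v := a)) = rank_space"
  using distr_pair_PiM_eq_PiM[of UNIV "\<lambda>_. unit_measure" v] unit_measure.prob_space_axioms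
  unfolding rank_space_eq by simp

lemma measurable_rank_update [measurable]:
  "(\<lambda>(a, y). y(v := a)) \<in> unit_measure \<Otimes>\<^sub>M rank_space \<rightarrow>\<^sub>M rank_space"
proof -
  have "(\<lambda>(a, y). (y(v := a)) w) \<in> unit_measure \<Otimes>\<^sub>M rank_space \<rightarrow>\<^sub>M unit_measure" for w
    by (cases "w = v") (simp_all add: case_prod_beta')
  then show ?thesis
    by (subst (2) rank_space_eq, intro measurable_PiM_single')
      (auto simp: case_prod_beta' space_pair_measure space_rank_space)
qed

lemma measurable_rank_update_fst:
  "y \<in> space rank_space \<Longrightarrow> (\<lambda>a. y(v := a)) \<in> unit_measure \<rightarrow>\<^sub>M rank_space"
  using measurable_compose[OF measurable_Pair2' measurable_rank_update, of y] by simp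

lemma rank_update_in_space: "y \<in> space rank_space \<Longrightarrow> a \<in> {0..1} \<Longrightarrow> y(v := a) \<in> space rank_space"
  by (auto simp: space_rank_space)

lemma rank_space_integral_resample:
  fixes h :: "(nat \<Rightarrow> real) \<Rightarrow> real"
  assumes h [measurable]: "h \<in> borel_measurable rank_space"
    and bound: "\<And>y. y \<in> space rank_space \<Longrightarrow> \<bar>h y\<bar> \<le> B"
  shows "(\<integral>y. h y \<partial>rank_space) = (\<integral>y. (\<integral>a. h (y(v := a)) \<partial>unit_measure) \<partial>rank_space)"
    and "(\<lambda>y. \<integral>a. h (y(v := a)) \<partial>unit_measure) \<in> borel_measurable rank_space"
proof -
  interpret P: pair_prob_space unit_measure rank_space ..
  have m: "(\<lambda>(a, y). h (y(v := a))) \<in> borel_measurable (unit_measure \<Otimes>\<^sub>M rank_space)"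
    using measurable_compose[OF measurable_rank_update h] by (simp add: case_prod_beta')
  have "integrable (unit_measure \<Otimes>\<^sub>M rank_space) (\<lambda>(a, y). h (y(v := a)))"
    using m bound rank_update_in_space
    by (intro P.P.integrable_const_bound[where B = B]) (auto simp: space_pair_measure intro!: AE_I2)
  then have "(\<integral>y. (\<integral>a. h (y(v := a)) \<partial>unit_measure) \<partial>rank_space) =
      (\<integral>z. (case z of (a, y) \<Rightarrow> h (y(v := a))) \<partial>(unit_measure \<Otimes>\<^sub>M rank_space))"
    using P.integral_snd[of "\<lambda>a y. h (y(v := a))"] by simp
  also have "\<dots> = (\<integral>y. h y \<partial>distr (unit_measure \<Otimes>\<^sub>M rank_space) rank_space (\<lambda>(a, y). y(v := a)))"
    by (subst integral_distr) (auto simp: case_prod_beta' )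
  finally show "(\<integral>y. h y \<partial>rank_space) = (\<integral>y. (\<integral>a. h (y(v := a)) \<partial>unit_measure) \<partial>rank_space)"
    unfolding rank_space_resample by simp
  have "(\<lambda>(y, a). h (y(v := a))) \<in> borel_measurable (rank_space \<Otimes>\<^sub>M unit_measure)"
    using measurable_compose[OF measurable_pair_swap' m] by (simp add: case_prod_beta')
  then show "(\<lambda>y. \<integral>a. h (y(v := a)) \<partial>unit_measure) \<in> borel_measurable rank_space"
    by (rule unit_measure.borel_measurable_lebesgue_integral)
qed

lemma unit_integral_abs_le:
  assumes "\<And>a. a \<in> {0..1} \<Longrightarrow> \<bar>h a\<bar> \<le> B" "0 \<le> B"
  shows "\<bar>\<integral>a. h a \<partial>unit_measure\<bar> \<le> (B :: real)"
proof (cases "integrable unit_measure h")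
  case True
  have "\<bar>\<integral>a. h a \<partial>unit_measure\<bar> \<le> (\<integral>a. \<bar>h a\<bar> \<partial>unit_measure)" by simp
  also have "\<dots> \<le> (\<integral>a. B \<partial>unit_measure)" using True assms by (intro integral_mono) auto
  finally show ?thesis using unit_measure.prob_space by simp
qed (use assms in \<open>simp add: not_integrable_integral_eq\<close>)

text \<open>Two successive applications of Fubini: a bound that holds after averaging over two
  ranks, for any fixed values of the others, holds in expectation.\<close>

lemma rank_space_integral_ge_resample2:
  fixes h :: "(nat \<Rightarrow> real) \<Rightarrow> real"
  assumes "u \<noteq> v" and h: "h \<in> borel_measurable rank_space"
    and bound: "\<And>y. y \<in> space rank_space \<Longrightarrow> \<bar>h y\<bar> \<le> B" "0 \<le> B"
    and C: "\<And>y. y \<in> space rank_space \<Longrightarrow>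
      C \<le> (\<integral>b. (\<integral>a. h (y(u := a, v := b)) \<partial>unit_measure) \<partial>unit_measure)"
  shows "C \<le> (\<integral>y. h y \<partial>rank_space)"
proof -
  define h2 where "h2 y = (\<integral>a. h (y(u := a)) \<partial>unit_measure)" for y
  have h2: "h2 \<in> borel_measurable rank_space"
    unfolding h2_def by (rule rank_space_integral_resample(2)[OF h bound(1)])
  have h2_bound: "\<bar>h2 y\<bar> \<le> B" if "y \<in> space rank_space" for y
    unfolding h2_def using bound rank_update_in_space that by (intro unit_integral_abs_le) auto
  define h3 where "h3 y = (\<integral>b. h2 (y(v := b)) \<partial>unit_measure)" for y
  have h3: "h3 \<in> borel_measurable rank_space"
    unfolding h3_def by (rule rank_space_integral_resample(2)[OF h2 h2_bound])
  have h3_bound: "\<bar>h3 y\<bar> \<le> B" if "y \<in> space rank_space" for y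
    unfolding h3_def using h2_bound bound(2) rank_update_in_space that by (intro unit_integral_abs_le) auto
  have "(\<integral>y. h y \<partial>rank_space) = (\<integral>y. h2 y \<partial>rank_space)"
    unfolding h2_def by (rule rank_space_integral_resample(1)[OF h bound(1)])
  also have "\<dots> = (\<integral>y. h3 y \<partial>rank_space)"
    unfolding h3_def by (rule rank_space_integral_resample(1)[OF h2 h2_bound])
  also have "C \<le> (\<integral>y. h3 y \<partial>rank_space)"
  proof -
    have "(\<integral>y. C \<partial>rank_space) \<le> (\<integral>y. h3 y \<partial>rank_space)"
    proof (rule integral_mono)
      show "integrable rank_space h3"
        using h3 h3_bound by (intro rank_space.integrable_const_bound[where B = B]) (auto intro!: AE_I2)
      show "C \<le> h3 y" if "y \<in> space rank_space" for y
        using C[OF that] assms(1) unfolding h3_def h2_def by (simp add: fun_upd_twist)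
    qed simp
    then show ?thesis by (simp add: rank_space.prob_space)
  qed
  finally show ?thesis .
qed

section \<open>Null events and ties\<close>

lemma AE_unit_neq: "AE a in unit_measure. a \<noteq> x"
proof -
  have "AE a in lborel. a \<noteq> x" by (rule AE_lborel_singleton)
  then show ?thesis unfolding unit_measure_def
    by (subst AE_restrict_space_iff) auto
qed

text \<open>The indicator of \<open>P\<close> has average \<open>1\<close> over the resampled
  coordinate, whatever the other ranks are, so its integral is \<open>1\<close>.\<close>

lemma AE_rank_space_resample:
  assumes P: "Measurable.pred rank_space P"
    and "\<And>y. y \<in> space rank_space \<Longrightarrow> AE a in unit_measure. P (y(v := a))"
  shows "AE y in rank_space. P y"
proof -
  have [measurable]: "Measurable.pred rank_space P" by (rule P)
  have m: "(\<lambda>y. if P y then 1 else 0 :: real) \<in> borel_measurable rank_space" by measurable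
  have "(\<integral>a. (if P (y(v := a)) then 1 else 0) \<partial>unit_measure) = (1 :: real)" if "y \<in> space rank_space" for y
  proof -
    have "(\<integral>a. (if P (y(v := a)) then 1 else 0) \<partial>unit_measure) = (\<integral>a. (1 :: real) \<partial>unit_measure)"
      using assms(2)[OF that] measurable_compose[OF measurable_rank_update_fst[OF that] m]
      by (intro integral_cong_AE) auto
    then show ?thesis using unit_measure.prob_space by simp
  qed
  then have "(\<integral>y. (\<integral>a. (if P (y(v := a)) then 1 else 0) \<partial>unit_measure) \<partial>rank_space) = (\<integral>y. (1 :: real) \<partial>rank_space)"
    by (intro Bochner_Integration.integral_cong) auto
  then have "(\<integral>y. (if P y then 1 else 0) \<partial>rank_space) = (\<integral>y. (1 :: real) \<partial>rank_space)"
    by (subst rank_space_integral_resample(1)[OF m, of 1 v]) auto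
  moreover have "(\<lambda>y. if P y then 1 else 0 :: real) = indicator {y. P y}"
    by (auto simp: indicator_def)
  ultimately have "rank_space.prob {y \<in> space rank_space. P y} = 1"
    by (simp add: rank_space.prob_space Int_def conj_commute)
  then show ?thesis using P rank_space.prob_eq_1 by (auto simp: pred_def)
qed

lemma AE_rank_no_tie:
  assumes "strict_mono_on {0..1} g" "continuous_on {0..1} g" "v \<noteq> w"
  shows "AE y in rank_space. g (y v) + r \<noteq> g (y w) + (s :: real)"
proof (rule AE_rank_space_resample[where v = v])
  have [measurable]: "g \<in> borel_measurable unit_measure"
    using assms(2) by (rule borel_measurable_continuous_unit)
  have [measurable]: "(\<lambda>y. g (y x)) \<in> borel_measurable rank_space" for x by measurable
  have "(\<lambda>y. g (y v) + r) \<in> borel_measurable rank_space" "(\<lambda>y. g (y w) + s) \<in> borel_measurable rank_space"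
    by measurable
  then show "Measurable.pred rank_space (\<lambda>y. g (y v) + r \<noteq> g (y w) + s)"
    unfolding pred_def by (rule borel_measurable_neq)
  fix y assume y: "y \<in> space rank_space"
  show "AE a in unit_measure. g ((y(v := a)) v) + r \<noteq> g ((y(v := a)) w) + s"
  \<comment> \<open>Since \<open>g\<close> is injective, at most one value of the resampled rank
    produces a tie.\<close>
  proof (cases "\<exists>x\<in>{0..1}. g x = g (y w) + s - r")
    case True
    then obtain x where x: "x \<in> {0..1}" "g x = g (y w) + s - r" by blast
    have "AE a in unit_measure. a \<noteq> x" by (rule AE_unit_neq)
    moreover have "AE a in unit_measure. a \<in> {0..1}" by (rule AE_I2) simp
    ultimately show ?thesis
    proof eventually_elim
      case (elim a)
      then have "g a \<noteq> g x" using strict_mono_on_imp_inj_on[OF assms(1)] x(1) by (auto dest: inj_onD)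
      then show ?case using x assms(3) by auto
    qed
  next
    case False
    have "AE a in unit_measure. a \<in> {0..1}" by (rule AE_I2) simp
    then show ?thesis
    proof eventually_elim
      case (elim a)
      then show ?case using False assms(3) by (auto simp: algebra_simps)
    qed
  qed
qed

section \<open>Integration over the ranks of the two endpoints\<close>

lemma unit_prob_lessThan:
  assumes "x \<in> {0..1}"
  shows "unit_measure.prob ({..<x} \<inter> {0..1}) = x"
proof -
  have "unit_measure.prob ({..<x} \<inter> {0..1}) = measure lborel ({..<x} \<inter> {0..1})"
    unfolding unit_measure_def by (rule measure_restrict_space) auto
  moreover have "{..<x} \<inter> {0..1} = {0..<x}" using assms by auto
  ultimately show ?thesis using assms by simp
qed

lemma unit_integral_indicator_br_g:
  assumes "x \<in> {0..1}"
  shows "(\<integral>a. indicator {..<x} a * br_g a \<partial>unit_measure) = br_G x"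
proof -
  have "(\<integral>a. indicator {..<x} a * br_g a \<partial>unit_measure) =
      (\<integral>a. indicator {0..1} a *\<^sub>R (indicator {..<x} a * br_g a) \<partial>lborel)"
    unfolding unit_measure_def by (rule integral_restrict_space) simp
  also have "\<dots> = (\<integral>a. indicator {0..x} a *\<^sub>R br_g a \<partial>lborel)"
  proof (rule integral_cong_AE)
    have "AE a in lborel. a \<noteq> x" by (rule AE_lborel_singleton)
    then show "AE a in lborel. indicator {0..1} a *\<^sub>R (indicator {..<x} a * br_g a) = indicator {0..x} a *\<^sub>R br_g a"
      by eventually_elim (use assms in \<open>auto split: split_indicator\<close>)
  qed (simp_all add: br_g_def)
  also have "\<dots> = br_G x - br_G 0"
  proof (rule integral_FTC_atLeastAtMost)
    show "(br_G has_vector_derivative br_g y) (at y within {0..x})" if "0 \<le> y" "y \<le> x" for y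
      using br_G_deriv[of y] by (rule has_vector_derivative_within_subset) (use assms that in auto)
    show "continuous_on {0..x} br_g"
      using continuous_on_br_g by (rule continuous_on_subset) (use assms in auto)
  qed (use assms in auto)
  finally show ?thesis by (simp add: br_G_def)
qed

lemma integrable_unit_bounded:
  assumes "h \<in> borel_measurable unit_measure" "\<And>a. a \<in> {0..1} \<Longrightarrow> \<bar>h a\<bar> \<le> B"
  shows "integrable unit_measure (h :: real \<Rightarrow> real)"
  using assms by (intro unit_measure.integrable_const_bound[where B = B]) (auto intro!: AE_I2)

lemma measurable_br_g [measurable]: "br_g \<in> borel_measurable unit_measure"
  by (rule borel_measurable_continuous_unit) (rule continuous_on_br_g)

lemma measurable_unit_ident [measurable]: "(\<lambda>a. a) \<in> borel_measurable unit_measure"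
  by (rule borel_measurable_continuous_unit) (rule continuous_on_id)

lemma measurable_unit_indicator [measurable]: "(indicator {..<x} :: real \<Rightarrow> real) \<in> borel_measurable unit_measure"
proof -
  have "(indicator {..<x} :: real \<Rightarrow> real) \<in> borel_measurable borel" by measurable
  from measurable_compose[OF measurable_unit_ident this] show ?thesis .
qed

lemma integrable_unit_indicator [simp]: "integrable unit_measure (indicator {..<x} :: real \<Rightarrow> real)"
  by (rule integrable_unit_bounded[where B = 1]) (auto split: split_indicator)

lemma integrable_unit_indicator_br_g [simp]: "integrable unit_measure (\<lambda>a. indicator {..<x} a * br_g a)"
proof (rule integrable_unit_bounded[where B = 1])
  show "\<bar>indicator {..<x} a * br_g a\<bar> \<le> 1" if "a \<in> {0..1}" for a
    using br_g_bounds[OF that] by (auto split: split_indicator)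
qed measurable

text \<open>To keep the integral elementary, the minimum in \<open>pair_bound\<close> is replaced by
  a step function in \<open>a\<close>. Moving \<open>\<theta>\<close> up to \<open>2/5\<close> gives
  \<open>A2 \<le> 1 - 319/600 - \<phi>\<close>. For \<open>a \<ge> 1/10\<close> this is below
  \<open>br_g a + 77/1000\<close>, because \<open>\<phi> \<ge> 39/1000\<close>; for smaller
  \<open>a\<close>, lowering it by \<open>e2\<close> replaces \<open>\<phi>\<close> by
  \<open>77/1000\<close>, and then \<open>br_g a \<ge> 319/1000\<close> suffices.\<close>

lemma pair_bound_br_g_ge:
  assumes "a \<in> {0..1}" "b \<in> {0..1}" "0 \<le> t" "t \<le> \<theta>" "\<theta> \<le> 1" "39/1000 \<le> \<phi>" "\<phi> \<le> 77/1000"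
    and A: "A = (if \<theta> < 1 then 1 - br_g \<theta> - \<phi> else 0)"
    and A2: "A2 = (if \<theta> < 1 then 1 - br_g (max \<theta> (2/5)) - \<phi> else 0)"
    and e2: "e2 = (if \<theta> < 1 then 77/1000 - \<phi> else 0)"
    and K: "K = indicator {..<t} b * A2 + (indicator {..<\<theta>} b - indicator {..<t} b) * (1 - \<phi>)
      + (1 - indicator {..<\<theta>} b) * A"
  shows "(indicator {..<\<tau>} a * br_g a + 77/1000 * indicator {..<\<tau>} a) + indicator {..<t} b * br_g b
     + (1 - indicator {..<\<tau>} a) * K
     - (indicator {..<t} b * e2) * (indicator {..<max \<tau> (1/10)} a - indicator {..<\<tau>} a)
    \<le> pair_bound br_g (77/1000) \<phi> \<tau> t \<theta> a b"
proof -
  have g_le: "br_g x \<le> br_g y" if "x \<le> y" "0 \<le> x" "y \<le> 1" for x y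
    using strict_mono_on_leD[OF strict_mono_br_g, of x y] that by auto
  have "319/600 \<le> br_g (max \<theta> (2/5))" using g_le[of "2/5" "max \<theta> (2/5)"] assms(5)
    by (simp add: br_g_def)
  moreover have "A2 \<le> A" using g_le[of \<theta> "max \<theta> (2/5)"] assms by (auto simp: A A2)
  moreover have "319/1000 \<le> br_g a" using br_g_bounds assms by auto
  moreover have "354/1000 \<le> br_g a" if "1/10 \<le> a"
    using g_le[of "1/10" a] that assms(1) by (simp add: br_g_def)
  ultimately have "A2 - (if a < 1/10 then e2 else 0) \<le> min (br_g a + 77/1000) A"
    using assms(6,7) by (auto simp: A A2 e2 min_def)
  then show ?thesis
    using assms(3,4) unfolding pair_bound_def Let_def A[symmetric] K
    by (auto split: split_indicator simp: max_def)
qed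

lemma unit_integral_pair_bound_ge:
  assumes H: "\<And>a b. a \<in> {0..1} \<Longrightarrow> b \<in> {0..1} \<Longrightarrow> a \<noteq> \<tau> \<Longrightarrow> b \<noteq> t \<Longrightarrow> b \<noteq> \<theta> \<Longrightarrow>
      pair_bound br_g (77/1000) \<phi> \<tau> t \<theta> a b \<le> h a b"
    and \<tau>: "0 \<le> \<tau>" "\<tau> \<le> 1" and t: "0 \<le> t" "t \<le> \<theta>" "\<theta> \<le> 1"
    and \<phi>: "39/1000 \<le> \<phi>" "\<phi> \<le> 77/1000"
    and h1: "\<And>b. b \<in> {0..1} \<Longrightarrow> integrable unit_measure (\<lambda>a. h a b)"
    and h2: "integrable unit_measure (\<lambda>b. \<integral>a. h a b \<partial>unit_measure)"
  shows "569/1000 + 76/10000 - (\<phi>\<^sup>2 - (39/1000)\<^sup>2) / (19/100) \<le> (\<integral>b. (\<integral>a. h a b \<partial>unit_measure) \<partial>unit_measure)"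
proof -
  define A where "A = (if \<theta> < 1 then 1 - br_g \<theta> - \<phi> else 0)"
  define A2 where "A2 = (if \<theta> < 1 then 1 - br_g (max \<theta> (2/5)) - \<phi> else 0)"
  define e2 where "e2 = (if \<theta> < 1 then 77/1000 - \<phi> else 0)"
  define K where "K b = indicator {..<t} b * A2 + (indicator {..<\<theta>} b - indicator {..<t} b) * (1 - \<phi>)
      + (1 - indicator {..<\<theta>} b) * A" for b
  \<comment> \<open>Each summand is a function of \<open>a\<close> times a function of
    \<open>b\<close>, so the double integral is read off factor by factor.\<close>
  define r where "r a b = (indicator {..<\<tau>} a * br_g a + 77/1000 * indicator {..<\<tau>} a) + indicator {..<t} b * br_g b
     + (1 - indicator {..<\<tau>} a) * K b
     - (indicator {..<t} b * e2) * (indicator {..<max \<tau> (1/10)} a - indicator {..<\<tau>} a)" for a b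
  have one: "unit_measure.prob {0..1} = 1" using unit_measure.prob_space by simp
  have r_int: "integrable unit_measure (\<lambda>a. r a b)" for b
    unfolding r_def by (intro Bochner_Integration.integrable_add Bochner_Integration.integrable_diff
      Bochner_Integration.integrable_mult_right Bochner_Integration.integrable_mult_left) simp_all
  have r_eq: "(\<integral>a. r a b \<partial>unit_measure) = (br_G \<tau> + 77/1000 * \<tau>) + indicator {..<t} b * br_g b
      + (1 - \<tau>) * K b - (indicator {..<t} b * e2) * max 0 (1/10 - \<tau>)" for b
    unfolding r_def using \<tau> one
    by (simp add: unit_prob_lessThan unit_integral_indicator_br_g max_def)
  have K_int: "integrable unit_measure K"
    unfolding K_def by (intro Bochner_Integration.integrable_add Bochner_Integration.integrable_diff
      Bochner_Integration.integrable_mult_right Bochner_Integration.integrable_mult_left) simp_all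
  have K_eq: "(\<integral>b. K b \<partial>unit_measure) = t * A2 + (\<theta> - t) * (1 - \<phi>) + (1 - \<theta>) * A"
    unfolding K_def using t one by (simp add: unit_prob_lessThan)
  have rr_int: "integrable unit_measure (\<lambda>b. \<integral>a. r a b \<partial>unit_measure)"
    unfolding r_eq using K_int by (intro Bochner_Integration.integrable_add Bochner_Integration.integrable_diff
      Bochner_Integration.integrable_mult_right Bochner_Integration.integrable_mult_left) simp_all
  have rr_eq: "(\<integral>b. (\<integral>a. r a b \<partial>unit_measure) \<partial>unit_measure) = (br_G \<tau> + 77/1000 * \<tau>) + br_G t
      + (1 - \<tau>) * (t * A2 + (\<theta> - t) * (1 - \<phi>) + (1 - \<theta>) * A) - (t * e2) * max 0 (1/10 - \<tau>)"
    unfolding r_eq using K_int t one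
    by (simp add: unit_prob_lessThan unit_integral_indicator_br_g K_eq)
  have "569/1000 + 76/10000 - (\<phi>\<^sup>2 - (39/1000)\<^sup>2) / (19/100) \<le> (\<integral>b. (\<integral>a. r a b \<partial>unit_measure) \<partial>unit_measure)"
  proof (cases "\<theta> < 1")
    case True
    have "(1 - \<tau>) * (t * A2 + (\<theta> - t) * (1 - \<phi>) + (1 - \<theta>) * A) - (t * e2) * max 0 (1/10 - \<tau>) =
       (1 - \<tau>) * ((\<theta> - t) * (1 - \<phi>) + (1 - \<theta>) * A) + t * ((1 - \<tau>) * A2 - e2 * max 0 (1/10 - \<tau>))"
      by algebra
    moreover have "569/1000 \<le> (\<phi>\<^sup>2 - (39/1000)\<^sup>2) / (19/100) - 76/10000 + (br_G \<tau> + 77/1000 * \<tau> + br_G t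
      + (1 - \<tau>) * ((\<theta> - t) * (1 - \<phi>) + (1 - \<theta>) * A) + t * ((1 - \<tau>) * A2 - e2 * max 0 (1/10 - \<tau>)))"
      unfolding A_def A2_def e2_def using True
      by (simp only: if_True) (rule main_ineq_lt, use \<tau> t \<phi> in auto)
    ultimately show ?thesis unfolding rr_eq by linarith
  next
    case False
    then have "\<theta> = 1" using t by simp
    then have "(1 - \<tau>) * (t * A2 + (\<theta> - t) * (1 - \<phi>) + (1 - \<theta>) * A) - (t * e2) * max 0 (1/10 - \<tau>) =
        (1 - \<tau>) * ((1 - t) * (1 - \<phi>))"
      by (simp add: A_def A2_def e2_def)
    then show ?thesis
      using main_ineq_one[of \<tau> t \<phi>] \<tau> t \<phi> unfolding rr_eq atLeastAtMost_iff by linarith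
  qed
  also have "\<dots> \<le> (\<integral>b. (\<integral>a. h a b \<partial>unit_measure) \<partial>unit_measure)"
  proof (rule integral_mono_AE[OF rr_int h2])
    have "AE b in unit_measure. b \<in> {0..1}" by (rule AE_I2) simp
    then show "AE b in unit_measure. (\<integral>a. r a b \<partial>unit_measure) \<le> (\<integral>a. h a b \<partial>unit_measure)"
      using AE_unit_neq[of t] AE_unit_neq[of \<theta>]
    proof eventually_elim
      case b: (elim b)
      show ?case
      proof (rule integral_mono_AE[OF r_int h1[OF b(1)]])
        have "AE a in unit_measure. a \<in> {0..1}" by (rule AE_I2) simp
        then show "AE a in unit_measure. r a b \<le> h a b"
          using AE_unit_neq[of \<tau>]
        proof eventually_elim
          case (elim a)
          have "r a b \<le> pair_bound br_g (77/1000) \<phi> \<tau> t \<theta> a b"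
            unfolding r_def
            by (rule pair_bound_br_g_ge[OF elim(1) b(1) t \<phi> A_def A2_def e2_def K_def])
          also have "\<dots> \<le> h a b" using elim b by (intro H)
          finally show ?case .
        qed
      qed
    qed
  qed
  finally show ?thesis .
qed

section \<open>Measurability and the division of the gain\<close>

context greedy_process
begin

lemma matched_Suc_iff:
  "x \<in> matched X y (Suc k) \<longleftrightarrow> x \<in> matched X y k \<or>
    (\<exists>u. dl k = Some u \<and> u \<notin> matched X y k \<and> (\<exists>w\<in>nb u. sel k y (matched X y k) u w \<and> (x = u \<or> x = w)))"
  by (auto simp: sel_def)

lemma measurable_sel:
  assumes g: "continuous_on {0..1} g" and S: "\<And>x. Measurable.pred rank_space (\<lambda>y. x \<in> S y)"
  shows "Measurable.pred rank_space (\<lambda>y. sel k y (S y) u w)"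
proof -
  have [measurable]: "g \<in> borel_measurable unit_measure"
    using g by (rule borel_measurable_continuous_unit)
  have m: "(\<lambda>y. g (y v) + c k v) \<in> borel_measurable rank_space" for v by measurable
  have less: "Measurable.pred rank_space (\<lambda>y. g (y v) + c k v < g (y w) + c k w)" for v w
    unfolding pred_def by (rule borel_measurable_less[OF m m])
  have eq: "Measurable.pred rank_space (\<lambda>y. g (y v) + c k v = g (y w) + c k w)" for v w
    unfolding pred_def by (rule borel_measurable_eq[OF m m])
  show ?thesis
    unfolding sel_def better_def Diff_iff Ball_def imp_conjL
    by (intro pred_intros_logic pred_intros_finite[where I = "nb u", unfolded Ball_def] S less eq measurable_const finite_nb) simp_all
qed

lemma measurable_matched:
  assumes g: "continuous_on {0..1} g"
  shows "Measurable.pred rank_space (\<lambda>y. x \<in> matched X y k)"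
proof (induction k arbitrary: x)
  case (Suc k)
  show ?case
  proof (cases "dl k")
    case None
    then show ?thesis using Suc by simp
  next
    case (Some u)
    then have "(\<lambda>y. x \<in> matched X y (Suc k)) = (\<lambda>y. x \<in> matched X y k \<or>
      u \<notin> matched X y k \<and> (\<exists>w\<in>nb u. sel k y (matched X y k) u w \<and> (x = u \<or> x = w)))"
      unfolding matched_Suc_iff by auto
    then show ?thesis
      by (simp only:, intro pred_intros_logic pred_intros_finite finite_nb Suc measurable_sel[OF g] measurable_const) simp_all
  qed
qed simp

definition passive_gain :: "nat \<Rightarrow> nat \<Rightarrow> (nat \<Rightarrow> real) \<Rightarrow> real" where
  "passive_gain j x y =
    (if x \<in> matched {} y (Suc j) \<and> x \<notin> matched {} y j \<and> dl j \<noteq> Some x then g (y x) + c j x else 0)"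

definition match_at :: "nat \<Rightarrow> (nat \<Rightarrow> real) \<Rightarrow> bool" where
  "match_at j y \<longleftrightarrow> (\<exists>u. dl j = Some u \<and> u \<notin> matched {} y j \<and> nb u - matched {} y j \<noteq> {})"

end

context bipartite_greedy_process
begin

definition vertex_gain :: "nat \<Rightarrow> nat \<Rightarrow> (nat \<Rightarrow> real) \<Rightarrow> real" where
  "vertex_gain n x y = (\<Sum>j<n. passive_gain j x y + (if dl j = Some x then active_gain x j y else 0))"

lemma not_in_nb_self: "u \<notin> nb u"
  using nb_L[of u] nb_R[of u] nb_empty[of u] LR_disjoint by blast

text \<open>The passive share \<open>g (y w) + c j w\<close> and the active share are complementary,
  so a match distributes exactly one unit.\<close>

lemma step_gain:
  assumes "finite V" "\<And>u. nb u \<subseteq> V" "\<And>u. dl j = Some u \<Longrightarrow> u \<in> V"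
  shows "(\<Sum>x\<in>V. passive_gain j x y + (if dl j = Some x then active_gain x j y else 0)) =
    (if match_at j y then 1 else 0)"
proof (cases "match_at j y")
  case True
  then obtain u where u: "dl j = Some u" "u \<notin> matched {} y j" "nb u - matched {} y j \<noteq> {}"
    by (auto simp: match_at_def)
  obtain w where w: "sel j y (matched {} y j) u w" using sel_exists[OF u(3)] by blast
  have wu: "w \<noteq> u" "w \<in> V" "w \<notin> matched {} y j" "w \<in> nb u"
    using w not_in_nb_self[of u] assms(2)[of u] by (auto simp: sel_def)
  have "sel j y (matched {} y j) u w' \<longleftrightarrow> w' = w" for w'
    using w sel_unique by blast
  then have "x \<in> matched {} y (Suc j) \<longleftrightarrow> x \<in> matched {} y j \<or> x = u \<or> x = w" for x
    unfolding matched_Suc_iff using u(1,2) wu(4) by auto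
  then have p: "passive_gain j x y = (if x = w then g (y w) + c j w else 0)" for x
    using wu u unfolding passive_gain_def by auto
  have a: "(if dl j = Some x then active_gain x j y else 0) = (if x = u then 1 - g (y w) - c j w else 0)" for x
    using active_gain_eq[OF u(2) w] u(1) by auto
  show ?thesis
    unfolding p a sum.distrib using assms u wu True by (simp add: sum.delta)
next
  case False
  then have no: "\<not> (dl j = Some u \<and> u \<notin> matched {} y j \<and> sel j y (matched {} y j) u w)" for u w
    by (auto simp: match_at_def sel_def)
  then have "passive_gain j x y = 0" for x
    unfolding passive_gain_def matched_Suc_iff by auto
  moreover have "(if dl j = Some x then active_gain x j y else 0) = 0" for x
    using no[of x] unfolding active_gain_def by (auto intro!: sum.neutral)
  ultimately show ?thesis using False by simp
qed

lemma sum_vertex_gain: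
  assumes "finite V" "\<And>u. nb u \<subseteq> V" "\<And>u j. dl j = Some u \<Longrightarrow> u \<in> V"
  shows "(\<Sum>x\<in>V. vertex_gain n x y) = (\<Sum>j<n. if match_at j y then 1 else 0)"
proof -
  have "(\<Sum>x\<in>V. vertex_gain n x y) =
      (\<Sum>j<n. \<Sum>x\<in>V. passive_gain j x y + (if dl j = Some x then active_gain x j y else 0))"
    unfolding vertex_gain_def by (rule sum.swap)
  also have "\<dots> = (\<Sum>j<n. if match_at j y then 1 else 0)"
    using assms by (intro sum.cong refl step_gain) auto
  finally show ?thesis .
qed

text \<open>A pathwise bound in a form whose expectation only involves water levels: the increments
  of \<open>I\<close> become increments of levels. The term with \<open>m\<close> withdraws the
  credit contained in \<open>pair_gain\<close>. The sum for \<open>v\<close> runs up to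
  \<open>Suc d\<close>, because step \<open>d\<close> itself may match \<open>v\<close>.\<close>

lemma vertex_gain_pair_ge:
  assumes g: "\<And>w. 0 \<le> g (y w)" and c: "\<And>j u w. dl j = Some u \<Longrightarrow> w \<in> nb u \<Longrightarrow> 0 \<le> c j w \<and> g (y w) + c j w \<le> 1"
    and dl: "dl d = Some u" "\<And>j. j < d \<Longrightarrow> dl j \<noteq> Some u" "\<And>j. j \<le> d \<Longrightarrow> dl j \<noteq> Some v" and "d < n"
  defines "I \<equiv> \<lambda>x j. if x \<in> matched {} y j then 1 else 0 :: real"
  shows "pair_gain m u v d y - m * I u d + (\<Sum>j<d. c j u * (I u (Suc j) - I u j))
    + (\<Sum>j<Suc d. c j v * (I v (Suc j) - I v j)) \<le> vertex_gain n u y + vertex_gain n v y"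
proof -
  have p_eq: "passive_gain j x y = (g (y x) + c j x) * (I x (Suc j) - I x j)" if "dl j \<noteq> Some x" for j x
    using that matched_mono[of j "Suc j" "{}" y] unfolding passive_gain_def I_def by auto
  have p_nn: "0 \<le> passive_gain j x y" for j x
  proof (cases "x \<in> matched {} y (Suc j) \<and> x \<notin> matched {} y j \<and> dl j \<noteq> Some x")
    case True
    then obtain u where "dl j = Some u" "x \<in> nb u" by (auto simp: sel_def)
    then show ?thesis using g[of x] c[of j u x] by (simp add: passive_gain_def)
  qed (auto simp: passive_gain_def)
  have a_nn: "0 \<le> (if dl j = Some x then active_gain x j y else 0)" for j x
    using c[of j x] by (auto intro!: active_gain_nonneg)
  \<comment> \<open>The rank is fixed, so its part telescopes; the offset varies from step to step
    and stays inside the sum.\<close>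
  have tele: "(\<Sum>j<k. (g (y x) + c j x) * (I x (Suc j) - I x j)) =
      g (y x) * I x k + (\<Sum>j<k. c j x * (I x (Suc j) - I x j))" for k x
  proof -
    have "(\<Sum>j<k. (g (y x) + c j x) * (I x (Suc j) - I x j)) =
        g (y x) * (\<Sum>j<k. I x (Suc j) - I x j) + (\<Sum>j<k. c j x * (I x (Suc j) - I x j))"
      by (simp add: distrib_right sum.distrib sum_distrib_left)
    moreover have "I x 0 = 0" by (simp add: I_def)
    ultimately show ?thesis by (simp add: sum_lessThan_telescope)
  qed
  have ge: "(\<Sum>j<Suc d. passive_gain j x y + (if dl j = Some x then active_gain x j y else 0)) \<le> vertex_gain n x y" for x
    unfolding vertex_gain_def using \<open>d < n\<close> p_nn a_nn by (intro sum_mono2) (auto intro!: add_nonneg_nonneg)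
  have "(\<Sum>j<d. passive_gain j u y + (if dl j = Some u then active_gain u j y else 0)) =
      (\<Sum>j<d. (g (y u) + c j u) * (I u (Suc j) - I u j))"
    using dl p_eq by (intro sum.cong) auto
  then have "g (y u) * I u d + (\<Sum>j<d. c j u * (I u (Suc j) - I u j)) + active_gain u d y \<le> vertex_gain n u y"
    using ge[of u] p_nn[of d u] dl(1) unfolding tele by simp
  moreover have "(\<Sum>j<Suc d. passive_gain j v y + (if dl j = Some v then active_gain v j y else 0)) =
      (\<Sum>j<Suc d. (g (y v) + c j v) * (I v (Suc j) - I v j))"
    using dl p_eq by (intro sum.cong) auto
  then have "g (y v) * I v (Suc d) + (\<Sum>j<Suc d. c j v * (I v (Suc j) - I v j)) \<le> vertex_gain n v y"
    using ge[of v] unfolding tele by simp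
  moreover have "pair_gain m u v d y = (g (y u) + m) * I u d + g (y v) * I v (Suc d) + active_gain u d y"
    unfolding pair_gain_def I_def by auto
  ultimately show ?thesis by (simp add: distrib_right del: sum.lessThan_Suc)
qed

lemma measurable_active_gain:
  assumes g: "continuous_on {0..1} g"
  shows "active_gain u d \<in> borel_measurable rank_space"
proof -
  have [measurable]: "g \<in> borel_measurable unit_measure"
    using g by (rule borel_measurable_continuous_unit)
  have [measurable]: "Measurable.pred rank_space (\<lambda>y. u \<notin> matched {} y d \<and> sel d y (matched {} y d) u w)" for w
    by (intro pred_intros_logic measurable_matched measurable_sel g)
  show ?thesis unfolding active_gain_def by measurable
qed

lemma measurable_passive_gain:
  assumes g: "continuous_on {0..1} g"
  shows "passive_gain j x \<in> borel_measurable rank_space"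
proof -
  have [measurable]: "g \<in> borel_measurable unit_measure"
    using g by (rule borel_measurable_continuous_unit)
  have [measurable]: "Measurable.pred rank_space
      (\<lambda>y. x \<in> matched {} y (Suc j) \<and> x \<notin> matched {} y j \<and> dl j \<noteq> Some x)"
    by (intro pred_intros_logic measurable_matched g measurable_const) simp
  show ?thesis unfolding passive_gain_def by measurable
qed

end

section \<open>The expected gain\<close>

locale balanced_process = bipartite_greedy_process dl nb c br_g L R
  for dl nb c L R +
  fixes V :: "nat set" and n :: nat
  assumes finite_V: "finite V" and nb_V: "nb u \<subseteq> V" and dl_V: "dl j = Some u \<Longrightarrow> u \<in> V"
    and dl_less: "dl j = Some u \<Longrightarrow> j < n"
    and dl_inj: "dl i = Some u \<Longrightarrow> dl j = Some u \<Longrightarrow> i = j"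
    and consistent: "dl j = Some u \<Longrightarrow> w \<in> nb u \<Longrightarrow>
      c j w = br_f (measure rank_space {y \<in> space rank_space. w \<in> matched {} y (Suc j)})"
begin

definition level :: "nat \<Rightarrow> nat \<Rightarrow> real" where
  "level x k = measure rank_space {y \<in> space rank_space. x \<in> matched {} y k}"

lemma matched_sets: "{y \<in> space rank_space. x \<in> matched {} y k} \<in> sets rank_space"
  using measurable_matched[OF continuous_on_br_g, of x "{}" k] by (simp add: pred_def)

lemma has_bochner_integral_matched:
  "has_bochner_integral rank_space (\<lambda>y. if x \<in> matched {} y k then 1 else 0) (level x k)"
proof -
  have "has_bochner_integral rank_space (indicator {y \<in> space rank_space. x \<in> matched {} y k}) (level x k)"
    unfolding level_def using matched_sets
    by (intro has_bochner_integral_real_indicator) (auto simp: rank_space.emeasure_eq_measure)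
  then show ?thesis
    by (rule has_bochner_integral_cong[THEN iffD1, rotated 3]) (auto simp: indicator_def)
qed

lemma level_mono: "j \<le> k \<Longrightarrow> level x j \<le> level x k"
  unfolding level_def using matched_mono[of j k "{}"] matched_sets
  by (intro rank_space.finite_measure_mono) auto

lemma c_bounds:
  assumes "dl j = Some u" "w \<in> nb u"
  shows "39/1000 \<le> c j w" "c j w \<le> 77/1000"
  using consistent[OF assms] br_f_bounds by auto

lemma key_bounds:
  assumes "dl j = Some u" "w \<in> nb u" "r \<in> {0..1}"
  shows "0 \<le> c j w" "br_g r + c j w \<le> 1" "0 \<le> br_g r"
  using c_bounds[OF assms(1,2)] br_g_bounds[OF assms(3)] by linarith+

text \<open>The sum is an upper Riemann sum, because \<open>br_f\<close> is monotone and \<open>c j x\<close> is \<open>br_f\<close> of the water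
  level after step \<open>j\<close>.\<close>

lemma br_F_level_le:
  assumes "\<And>j. j < k \<Longrightarrow> dl j \<noteq> Some x"
  shows "br_F (level x k) \<le> (\<Sum>j<k. c j x * (level x (Suc j) - level x j))"
proof -
  have step: "br_F (level x (Suc j)) - br_F (level x j) \<le> c j x * (level x (Suc j) - level x j)"
    if j: "j < k" for j
  proof (cases "\<exists>u. dl j = Some u \<and> x \<in> nb u")
    case True
    then have "c j x = br_f (level x (Suc j))" using consistent by (auto simp: level_def)
    then show ?thesis using br_F_diff_le[OF level_mono[of j "Suc j" x]] by simp
  next
    case False
    have "x \<in> matched {} y (Suc j) \<longleftrightarrow> x \<in> matched {} y j" for y
      using False assms[OF j] unfolding matched_Suc_iff by auto
    then have "level x (Suc j) = level x j" unfolding level_def by simp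
    then show ?thesis by simp
  qed
  have "level x 0 = 0" by (simp add: level_def)
  then have "br_F (level x k) = (\<Sum>j<k. br_F (level x (Suc j)) - br_F (level x j))"
    using sum_lessThan_telescope[of "\<lambda>j. br_F (level x j)" k] by simp
  also have "\<dots> \<le> (\<Sum>j<k. c j x * (level x (Suc j) - level x j))"
    using step by (intro sum_mono) auto
  finally show ?thesis .
qed

lemma active_gain_bound:
  assumes "dl d = Some u" "y \<in> space rank_space"
  shows "\<bar>active_gain u d y\<bar> \<le> real (card (nb u))"
proof -
  have "\<bar>active_gain u d y\<bar> \<le> (\<Sum>w\<in>nb u. \<bar>if u \<notin> matched {} y d \<and> sel d y (matched {} y d) u w
      then 1 - br_g (y w) - c d w else 0\<bar>)"
    unfolding active_gain_def by (rule sum_abs)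
  also have "\<dots> \<le> (\<Sum>w\<in>nb u. 1)"
  proof (rule sum_mono)
    fix w assume w: "w \<in> nb u"
    have "y w \<in> {0..1}" using assms(2) by (auto simp: space_rank_space)
    from key_bounds[OF assms(1) w this]
    show "\<bar>if u \<notin> matched {} y d \<and> sel d y (matched {} y d) u w then 1 - br_g (y w) - c d w else 0\<bar> \<le> 1"
      by simp
  qed
  finally show ?thesis by simp
qed

lemma integrable_active_gain:
  assumes "dl d = Some u"
  shows "integrable rank_space (active_gain u d)"
  using measurable_active_gain[OF continuous_on_br_g] active_gain_bound[OF assms]
  by (intro rank_space.integrable_const_bound[where B = "real (card (nb u))"]) (auto intro!: AE_I2)

lemma integrable_vertex_gain: "integrable rank_space (vertex_gain k x)"
proof -
  have "integrable rank_space (passive_gain j x)" for j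
  proof (rule rank_space.integrable_const_bound[where B = 1])
    show "AE y in rank_space. norm (passive_gain j x y) \<le> 1"
    proof (rule AE_I2)
      fix y assume y: "y \<in> space rank_space"
      then have yx: "y x \<in> {0..1}" by (auto simp: space_rank_space)
      show "norm (passive_gain j x y) \<le> 1"
      proof (cases "x \<in> matched {} y (Suc j) \<and> x \<notin> matched {} y j \<and> dl j \<noteq> Some x")
        case True
        then obtain u where "dl j = Some u" "x \<in> nb u" by (auto simp: sel_def)
        then show ?thesis using key_bounds[of j u x "y x"] yx by (simp add: passive_gain_def)
      qed (auto simp: passive_gain_def)
    qed
  qed (rule measurable_passive_gain[OF continuous_on_br_g])
  moreover have "integrable rank_space (\<lambda>y. if dl j = Some x then active_gain x j y else 0)" for j
    using integrable_active_gain[of j x] by (cases "dl j = Some x") auto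
  ultimately show ?thesis
    unfolding vertex_gain_def[abs_def]
    by (intro Bochner_Integration.integrable_sum Bochner_Integration.integrable_add)
qed

lemma vertex_gain_nonneg:
  assumes y: "y \<in> space rank_space"
  shows "0 \<le> vertex_gain k x y"
  unfolding vertex_gain_def
proof (intro sum_nonneg add_nonneg_nonneg)
  fix j
  have y01: "y w \<in> {0..1}" for w using y by (auto simp: space_rank_space)
  show "0 \<le> passive_gain j x y"
  proof (cases "x \<in> matched {} y (Suc j) \<and> x \<notin> matched {} y j \<and> dl j \<noteq> Some x")
    case True
    then obtain u where "dl j = Some u" "x \<in> nb u" by (auto simp: sel_def)
    then show ?thesis using key_bounds[of j u x "y x"] y01[of x] by (simp add: passive_gain_def)
  qed (auto simp: passive_gain_def)
  show "0 \<le> (if dl j = Some x then active_gain x j y else 0)"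
    using key_bounds(2)[OF _ _ y01] by (auto intro!: active_gain_nonneg)
qed

lemma expected_pair_gain_ge:
  assumes uv: "v \<in> nb u" and dl: "dl d = Some u" "\<And>j. j \<le> d \<Longrightarrow> dl j \<noteq> Some v"
  shows "integrable rank_space (pair_gain (77/1000) u v d)"
    and "569/1000 + 76/10000 - ((c d v)\<^sup>2 - (39/1000)\<^sup>2) / (19/100) \<le> (\<integral>y. pair_gain (77/1000) u v d y \<partial>rank_space)"
proof -
  let ?h = "pair_gain (77/1000) u v d"
  have meas: "?h \<in> borel_measurable rank_space"
  proof -
    have [measurable]: "active_gain u d \<in> borel_measurable rank_space"
      by (rule measurable_active_gain[OF continuous_on_br_g])
    have [measurable]: "Measurable.pred rank_space (\<lambda>y. u \<in> matched {} y d)"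
      "Measurable.pred rank_space (\<lambda>y. v \<in> matched {} y (Suc d))"
      by (rule measurable_matched[OF continuous_on_br_g])+
    show ?thesis unfolding pair_gain_def[abs_def] by measurable
  qed
  have bound: "\<bar>?h y\<bar> \<le> 2 + real (card (nb u))" if y: "y \<in> space rank_space" for y
  proof -
    have y01: "y w \<in> {0..1}" for w using y by (auto simp: space_rank_space)
    have "\<bar>if u \<in> matched {} y d then br_g (y u) + 77/1000 else 0\<bar> \<le> 1"
      "\<bar>if v \<in> matched {} y (Suc d) then br_g (y v) else 0\<bar> \<le> 1"
      using br_g_bounds[OF y01, of u] br_g_bounds[OF y01, of v] by simp_all
    then show ?thesis using active_gain_bound[OF dl(1) y] unfolding pair_gain_def by linarith
  qed
  show "integrable rank_space ?h"
    using meas bound by (intro rank_space.integrable_const_bound[where B = "2 + real (card (nb u))"]) (auto intro!: AE_I2)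
  have no_u: "dl j \<noteq> Some u" if "j < d" for j
    using dl_inj[OF dl(1), of j] that by auto
  have neq: "u \<noteq> v" using uv not_in_nb_self by auto
  show "569/1000 + 76/10000 - ((c d v)\<^sup>2 - (39/1000)\<^sup>2) / (19/100) \<le> (\<integral>y. ?h y \<partial>rank_space)"
  proof (rule rank_space_integral_ge_resample2[OF neq meas bound])
    fix y assume y: "y \<in> space rank_space"
    then have y01: "y w \<in> {0..1}" for w by (auto simp: space_rank_space)
    have "u \<in> L \<union> R" using uv nb_empty by fastforce
    then obtain \<tau> t \<theta> where th: "0 \<le> \<tau>" "\<tau> \<le> 1" "0 \<le> t" "t \<le> \<theta>" "\<theta> \<le> 1"
      and H: "\<And>a b. a \<in> {0..1} \<Longrightarrow> b \<in> {0..1} \<Longrightarrow> a \<noteq> \<tau> \<Longrightarrow> b \<noteq> t \<Longrightarrow> b \<noteq> \<theta> \<Longrightarrow>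
        pair_bound br_g (77/1000) (c d v) \<tau> t \<theta> a b \<le> ?h (y(u := a, v := b))"
    proof
      assume "u \<in> L"
      show ?thesis
        by (rule pair_gain_ge_pair_bound[where y = y and m = "77/1000", OF strict_mono_on_imp_mono_on[OF strict_mono_br_g] continuous_on_br_g
            _ _ \<open>u \<in> L\<close> uv dl(1) no_u dl(2) y01])
          (use key_bounds[OF dl(1)] uv that in auto)
    next
      assume "u \<in> R"
      \<comment> \<open>The process does not distinguish the two sides, so this case is the previous
        one with \<open>L\<close> and \<open>R\<close> exchanged.\<close>
      interpret sw: bipartite_greedy_process dl nb c br_g R L
        using LR_disjoint nb_L nb_R nb_empty by unfold_locales auto
      show ?thesis
        by (rule sw.pair_gain_ge_pair_bound[where y = y and m = "77/1000", OF strict_mono_on_imp_mono_on[OF strict_mono_br_g] continuous_on_br_g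
            _ _ \<open>u \<in> R\<close> uv dl(1) no_u dl(2) y01])
          (use key_bounds[OF dl(1)] uv that in auto)
    qed
    have in_sp: "y(u := a, v := b) \<in> space rank_space" if "a \<in> {0..1}" "b \<in> {0..1}" for a b
      using y that by (intro rank_update_in_space)
    have m_v: "(\<lambda>b. ?h (y(u := a, v := b))) \<in> borel_measurable unit_measure" if "a \<in> {0..1}" for a
      using measurable_compose[OF measurable_rank_update_fst[OF rank_update_in_space[OF y that, of u], of v] meas] .
    show "569/1000 + 76/10000 - ((c d v)\<^sup>2 - (39/1000)\<^sup>2) / (19/100)
      \<le> (\<integral>b. (\<integral>a. ?h (y(u := a, v := b)) \<partial>unit_measure) \<partial>unit_measure)"
    proof (rule unit_integral_pair_bound_ge[OF H th c_bounds[OF dl(1) uv]])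
      show "integrable unit_measure (\<lambda>a. ?h (y(u := a, v := b)))" if b: "b \<in> {0..1}" for b
      proof (rule integrable_unit_bounded)
        have "(\<lambda>a. ?h (y(v := b, u := a))) \<in> borel_measurable unit_measure"
          using measurable_compose[OF measurable_rank_update_fst[OF rank_update_in_space[OF y b, of v], of u] meas] .
        then show "(\<lambda>a. ?h (y(u := a, v := b))) \<in> borel_measurable unit_measure"
          using neq by (simp add: fun_upd_twist)
        show "\<bar>?h (y(u := a, v := b))\<bar> \<le> 2 + real (card (nb u))" if "a \<in> {0..1}" for a
          using bound in_sp that b by blast
      qed
      have "(\<lambda>z. \<integral>a. ?h (z(u := a)) \<partial>unit_measure) \<in> borel_measurable rank_space"
        by (rule rank_space_integral_resample(2)[OF meas bound])
      from measurable_compose[OF measurable_rank_update_fst[OF y, of v] this]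
      have "(\<lambda>b. \<integral>a. ?h (y(v := b, u := a)) \<partial>unit_measure) \<in> borel_measurable unit_measure" .
      then have m: "(\<lambda>b. \<integral>a. ?h (y(u := a, v := b)) \<partial>unit_measure) \<in> borel_measurable unit_measure"
        using neq by (simp add: fun_upd_twist)
      show "integrable unit_measure (\<lambda>b. \<integral>a. ?h (y(u := a, v := b)) \<partial>unit_measure)"
        using bound in_sp
        by (intro integrable_unit_bounded[OF m, of "2 + real (card (nb u))"] unit_integral_abs_le) auto
    qed
  qed (assumption | rule add_nonneg_nonneg of_nat_0_le_iff zero_le_numeral)+
qed

lemma expected_vertex_gain_pair:
  assumes uv: "v \<in> nb u" and dl: "dl d = Some u" "\<And>j. j \<le> d \<Longrightarrow> dl j \<noteq> Some v"
  shows "569/1000 \<le> (\<integral>y. vertex_gain n u y \<partial>rank_space) + (\<integral>y. vertex_gain n v y \<partial>rank_space)"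
proof -
  let ?h = "pair_gain (77/1000) u v d"
  let ?I = "\<lambda>x j y. if x \<in> matched {} y j then 1 else 0 :: real"
  have no_u: "dl j \<noteq> Some u" if "j < d" for j
    using dl_inj[OF dl(1), of j] that by auto
  note hI = has_bochner_integral_matched
  note pg = expected_pair_gain_ge[OF assms]
  have total: "has_bochner_integral rank_space
      (\<lambda>y. ?h y - 77/1000 * ?I u d y + (\<Sum>j<d. c j u * (?I u (Suc j) y - ?I u j y))
        + (\<Sum>j<Suc d. c j v * (?I v (Suc j) y - ?I v j y)))
      ((\<integral>y. ?h y \<partial>rank_space) - 77/1000 * level u d + (\<Sum>j<d. c j u * (level u (Suc j) - level u j))
        + (\<Sum>j<Suc d. c j v * (level v (Suc j) - level v j)))"
    by (intro has_bochner_integral_add has_bochner_integral_diff has_bochner_integral_sum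
      has_bochner_integral_mult_right hI has_bochner_integral_integrable pg(1))
  have "(\<integral>y. ?h y - 77/1000 * ?I u d y + (\<Sum>j<d. c j u * (?I u (Suc j) y - ?I u j y))
      + (\<Sum>j<Suc d. c j v * (?I v (Suc j) y - ?I v j y)) \<partial>rank_space) \<le>
      (\<integral>y. vertex_gain n u y + vertex_gain n v y \<partial>rank_space)"
  proof (rule integral_mono)
    fix y assume y: "y \<in> space rank_space"
    then have y01: "y w \<in> {0..1}" for w by (auto simp: space_rank_space)
    show "?h y - 77/1000 * ?I u d y + (\<Sum>j<d. c j u * (?I u (Suc j) y - ?I u j y))
      + (\<Sum>j<Suc d. c j v * (?I v (Suc j) y - ?I v j y)) \<le> vertex_gain n u y + vertex_gain n v y"
    proof (rule vertex_gain_pair_ge[OF _ _ dl(1) no_u dl(2) dl_less[OF dl(1)]])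
      show "0 \<le> br_g (y w)" for w using br_g_bounds(1)[OF y01, of w] by linarith
      show "0 \<le> c j w \<and> br_g (y w) + c j w \<le> 1" if "dl j = Some x" "w \<in> nb x" for j x w
        using key_bounds[OF that y01] by blast
    qed
  next
    show "integrable rank_space (\<lambda>y. vertex_gain n u y + vertex_gain n v y)"
      using integrable_vertex_gain by (intro Bochner_Integration.integrable_add)
    show "integrable rank_space (\<lambda>y. ?h y - 77/1000 * ?I u d y + (\<Sum>j<d. c j u * (?I u (Suc j) y - ?I u j y))
      + (\<Sum>j<Suc d. c j v * (?I v (Suc j) y - ?I v j y)))"
      using total by (simp only: has_bochner_integral_iff)
  qed
  also have "(\<integral>y. vertex_gain n u y + vertex_gain n v y \<partial>rank_space) =
      (\<integral>y. vertex_gain n u y \<partial>rank_space) + (\<integral>y. vertex_gain n v y \<partial>rank_space)"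
    by (rule Bochner_Integration.integral_add[OF integrable_vertex_gain integrable_vertex_gain])
  also have "(\<integral>y. ?h y - 77/1000 * ?I u d y + (\<Sum>j<d. c j u * (?I u (Suc j) y - ?I u j y))
      + (\<Sum>j<Suc d. c j v * (?I v (Suc j) y - ?I v j y)) \<partial>rank_space) =
     (\<integral>y. ?h y \<partial>rank_space) - 77/1000 * level u d + (\<Sum>j<d. c j u * (level u (Suc j) - level u j))
      + (\<Sum>j<Suc d. c j v * (level v (Suc j) - level v j))"
    using total by (rule has_bochner_integral_integral_eq)
  finally have main: "(\<integral>y. ?h y \<partial>rank_space) - 77/1000 * level u d + (\<Sum>j<d. c j u * (level u (Suc j) - level u j))
      + (\<Sum>j<Suc d. c j v * (level v (Suc j) - level v j)) \<le>
      (\<integral>y. vertex_gain n u y \<partial>rank_space) + (\<integral>y. vertex_gain n v y \<partial>rank_space)" .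
  have "br_F (level u d) \<le> (\<Sum>j<d. c j u * (level u (Suc j) - level u j))"
    using no_u by (rule br_F_level_le)
  moreover have "br_F (level v (Suc d)) \<le> (\<Sum>j<Suc d. c j v * (level v (Suc j) - level v j))"
    using dl(2) by (intro br_F_level_le) auto
  moreover have "c d v = br_f (level v (Suc d))" using consistent[OF dl(1) uv] by (simp add: level_def)
  then have "((c d v)\<^sup>2 - (39/1000)\<^sup>2) / (19/100) \<le> br_F (level v (Suc d))"
    using br_F_ge_br_f[of "level v (Suc d)"] by (simp only:) (simp add: level_def)
  \<comment> \<open>Both corrections in the bound on \<open>pair_gain\<close> cancel: the tangent
    for \<open>u\<close> costs \<open>76/10000\<close>, and the integral for \<open>v\<close>
    supplies the quadratic in \<open>c d v\<close>.\<close>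
  ultimately show ?thesis
    using pg(2) main br_F_tangent[of "level u d"] by linarith
qed

text \<open>Disjoint edges charge disjoint sets of vertices, and uncovered vertices have
  non-negative gain.\<close>

lemma expected_matches_ge:
  assumes M: "finite M" "disjoint M"
    and edge: "\<And>e. e \<in> M \<Longrightarrow> \<exists>u v d. e = {u, v} \<and> v \<in> nb u \<and> dl d = Some u \<and> (\<forall>j\<le>d. dl j \<noteq> Some v)"
  shows "569/1000 * real (card M) \<le> (\<integral>y. (\<Sum>j<n. if match_at j y then 1 else 0) \<partial>rank_space)"
proof -
  let ?E = "\<lambda>x. \<integral>y. vertex_gain n x y \<partial>rank_space"
  have E_nonneg: "0 \<le> ?E x" for x
    using vertex_gain_nonneg by (intro Bochner_Integration.integral_nonneg) auto
  have edge_sum: "569/1000 \<le> (\<Sum>x\<in>e. ?E x)" and edge_V: "e \<subseteq> V" if eM: "e \<in> M" for e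
  proof -
    obtain u v d where e: "e = {u, v}" "v \<in> nb u" "dl d = Some u" "\<And>j. j \<le> d \<Longrightarrow> dl j \<noteq> Some v"
      using edge[OF eM] by blast
    have "u \<noteq> v" using e not_in_nb_self by auto
    then show "569/1000 \<le> (\<Sum>x\<in>e. ?E x)" using expected_vertex_gain_pair[OF e(2-4)] e(1) by simp
    show "e \<subseteq> V" using e nb_V[of u] dl_V by auto
  qed
  have "569/1000 * real (card M) = (\<Sum>e\<in>M. 569/1000)" by simp
  also have "\<dots> \<le> (\<Sum>e\<in>M. \<Sum>x\<in>e. ?E x)" by (rule sum_mono) (rule edge_sum)
  also have "\<dots> = (\<Sum>x\<in>\<Union>M. ?E x)"
    using M edge_V finite_V by (subst sum.Union_disjoint) (auto simp: disjoint_def intro: finite_subset[OF edge_V finite_V])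
  also have "\<dots> \<le> (\<Sum>x\<in>V. ?E x)"
    using finite_V edge_V E_nonneg by (intro sum_mono2) auto
  also have "\<dots> = (\<integral>y. (\<Sum>x\<in>V. vertex_gain n x y) \<partial>rank_space)"
    using integrable_vertex_gain by (subst Bochner_Integration.integral_sum) auto
  also have "\<dots> = (\<integral>y. (\<Sum>j<n. if match_at j y then 1 else 0) \<partial>rank_space)"
    using sum_vertex_gain[OF finite_V nb_V dl_V] by simp
  finally show ?thesis .
qed

end

section \<open>Balanced Ranking as a greedy process\<close>

lemma arg_max_on_finite:
  fixes f :: "'a \<Rightarrow> real"
  assumes "finite N" "N \<noteq> {}"
  shows "arg_max_on f N \<in> N" "\<And>w. w \<in> N \<Longrightarrow> f w \<le> f (arg_max_on f N)"
proof -
  have "Max (f ` N) \<in> f ` N" using assms by (intro Max_in) auto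
  then obtain x where "x \<in> N" "f x = Max (f ` N)" by auto
  then have "is_arg_max f (\<lambda>x. x \<in> N) x" using assms by (auto simp: is_arg_max_linorder)
  then have "is_arg_max f (\<lambda>x. x \<in> N) (arg_max_on f N)"
    unfolding arg_max_on_def arg_max_def by (rule someI)
  then show "arg_max_on f N \<in> N" "\<And>w. w \<in> N \<Longrightarrow> f w \<le> f (arg_max_on f N)"
    by (auto simp: is_arg_max_linorder)
qed

text \<open>The selected maximiser depends only on the set of maximisers. This is what makes the run
  measurable despite the unspecified choice.\<close>

lemma arg_max_on_eq_Eps:
  fixes f :: "'a \<Rightarrow> real"
  shows "arg_max_on f N = (SOME x. x \<in> {x \<in> N. \<forall>w\<in>N. f w \<le> f x})"
proof -
  have "is_arg_max f (\<lambda>x. x \<in> N) = (\<lambda>x. x \<in> {x \<in> N. \<forall>w\<in>N. f w \<le> f x})"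
    by (auto simp: is_arg_max_linorder fun_eq_iff)
  then show ?thesis unfolding arg_max_on_def arg_max_def by (simp only:)
qed

section \<open>Instances and what is observed of them\<close>

locale online_instance =
  fixes V :: "nat set" and E :: "nat set set" and \<sigma> :: "event list" and L R :: "nat set"
  assumes inst: "fully_online_instance V E \<sigma>"
    and V_eq: "V = L \<union> R" and LR_disj: "L \<inter> R = {}"
    and E_LR: "\<And>e. e \<in> E \<Longrightarrow> \<exists>u\<in>L. \<exists>v\<in>R. e = {u, v}"
begin

definition nb :: "nat \<Rightarrow> nat set" where
  "nb u = {v. {u, v} \<in> E}"

definition dl :: "nat \<Rightarrow> nat option" where
  "dl k = (if k < length \<sigma> then (case \<sigma> ! k of Arrival _ \<Rightarrow> None | Deadline u \<Rightarrow> Some u) else None)"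

lemma dl_eq_Some: "dl k = Some u \<longleftrightarrow> k < length \<sigma> \<and> \<sigma> ! k = Deadline u"
  by (auto simp: dl_def split: event.splits)

lemma finite_V: "finite V" and E_sub: "\<And>e. e \<in> E \<Longrightarrow> e \<subseteq> V \<and> card e = 2"
  and distinct_\<sigma>: "distinct \<sigma>" and set_\<sigma>: "set \<sigma> = Arrival ` V \<union> Deadline ` V"
  using inst by (auto simp: fully_online_instance_def simple_graph_def)

lemma finite_E: "finite E"
  using finite_V E_sub by (intro finite_subset[of E "Pow V"]) auto

lemma nb_sym: "v \<in> nb u \<longleftrightarrow> u \<in> nb v"
  by (simp add: nb_def insert_commute)

lemma nb_subset_V: "nb u \<subseteq> V"
  using E_sub by (auto simp: nb_def)

lemma nb_nonempty_V: "v \<in> nb u \<Longrightarrow> u \<in> V"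
  using nb_sym nb_subset_V by blast

lemma nb_sides: "u \<in> L \<Longrightarrow> nb u \<subseteq> R" "u \<in> R \<Longrightarrow> nb u \<subseteq> L"
proof -
  have "v \<in> R \<and> u \<in> L \<or> v \<in> L \<and> u \<in> R" if v: "v \<in> nb u" for u v
  proof -
    from v have "{u, v} \<in> E" by (simp add: nb_def)
    then obtain a b where "a \<in> L" "b \<in> R" "{u, v} = {a, b}" using E_LR by blast
    then show ?thesis by (auto simp: doubleton_eq_iff)
  qed
  then show "u \<in> L \<Longrightarrow> nb u \<subseteq> R" "u \<in> R \<Longrightarrow> nb u \<subseteq> L"
    using LR_disj by blast+
qed

lemma precedes_index:
  assumes "precedes \<sigma> a (Deadline u)" "k < length \<sigma>" "\<sigma> ! k = Deadline u"
  shows "a \<in> set (take k \<sigma>)"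
proof -
  obtain i j where ij: "i < j" "j < length \<sigma>" "\<sigma> ! i = a" "\<sigma> ! j = Deadline u"
    using assms(1) by (auto simp: precedes_def)
  then have "j = k" using assms nth_eq_iff_index_eq[OF distinct_\<sigma>, of j k] by simp
  then show ?thesis using ij by (auto simp: set_conv_nth intro!: exI[of _ i])
qed

lemma neighbour_arrived:
  assumes "k < length \<sigma>" "\<sigma> ! k = Deadline u" "v \<in> nb u"
  shows "Arrival v \<in> set (take k \<sigma>)"
  using inst assms precedes_index[of "Arrival v" u k] by (auto simp: fully_online_instance_def nb_def)

lemma self_arrived:
  assumes "k < length \<sigma>" "\<sigma> ! k = Deadline u"
  shows "Arrival u \<in> set (take k \<sigma>)"
proof -
  have "Deadline u \<in> set \<sigma>" using assms by (metis nth_mem)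
  then have "u \<in> V" using set_\<sigma> by auto
  then show ?thesis using inst assms precedes_index[of "Arrival u" u k] by (auto simp: fully_online_instance_def)
qed

text \<open>By the deadline of \<open>u\<close>, \<open>u\<close> and all its neighbours have
  arrived, so the revealed neighbourhood is already the full one.\<close>

lemma observed_neighbours:
  assumes "k < length \<sigma>" "\<sigma> ! k = Deadline u"
  shows "{u, v} \<in> snd (observation E (take (Suc k) \<sigma>)) \<longleftrightarrow> v \<in> nb u"
proof -
  have "set (take k \<sigma>) \<subseteq> set (take (Suc k) \<sigma>)" by (rule set_take_subset_set_take) simp
  then show ?thesis
    using neighbour_arrived[OF assms, of v] self_arrived[OF assms] by (auto simp: observation_def nb_def)
qed

lemma last_observation: "k < length \<sigma> \<Longrightarrow> last (fst (observation E (take (Suc k) \<sigma>))) = \<sigma> ! k"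
  by (simp add: observation_def take_Suc_conv_app_nth)

end

sublocale online_instance \<subseteq> bip: bipartite_greedy_process dl nb c br_g L R for c
proof unfold_locales
  show "finite (nb u)" for u using nb_subset_V finite_V by (rule finite_subset)
  show "nb u = {}" if "u \<notin> L \<union> R" for u using that nb_nonempty_V V_eq by blast
qed (use LR_disj nb_sides in auto)

locale online_run = online_instance V E \<sigma> L R for V E \<sigma> L R +
  fixes fhat :: "observation \<Rightarrow> nat \<Rightarrow> real"
begin

definition c :: "nat \<Rightarrow> nat \<Rightarrow> real" where
  "c k = fhat (observation E (take (Suc k) \<sigma>))"

abbreviation "edges y k \<equiv> run (balanced_ranking br_g fhat) E \<sigma> y k"
abbreviation "matched \<equiv> greedy_process.matched dl nb c br_g"
abbreviation "sel \<equiv> greedy_process.sel nb c br_g"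
abbreviation "match_at \<equiv> greedy_process.match_at dl nb c br_g"

lemma edges_Suc:
  assumes "k < length \<sigma>"
  shows "edges y (Suc k) = edges y k \<union>
    balanced_ranking br_g fhat (observation E (take (Suc k) \<sigma>)) y (edges y k)"
  by simp

lemma step_Arrival:
  assumes "k < length \<sigma>" "\<sigma> ! k = Arrival u"
  shows "balanced_ranking br_g fhat (observation E (take (Suc k) \<sigma>)) y M = {}"
  using last_observation[OF assms(1)] assms(2) by (simp add: balanced_ranking_def)

lemma step_Deadline:
  assumes "k < length \<sigma>" "\<sigma> ! k = Deadline u"
  shows "balanced_ranking br_g fhat (observation E (take (Suc k) \<sigma>)) y M =
    (if u \<in> \<Union>M \<or> nb u - \<Union>M = {} then {}
     else {{u, arg_max_on (\<lambda>v. 1 - br_g (y v) - c k v) (nb u - \<Union>M)}})"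
proof -
  have "{v. {u, v} \<in> snd (observation E (take (Suc k) \<sigma>)) \<and> v \<notin> \<Union>M} = nb u - \<Union>M"
    using observed_neighbours[OF assms] by auto
  then show ?thesis
    using last_observation[OF assms(1)] assms(2) by (simp add: balanced_ranking_def c_def Let_def)
qed

lemma finite_nb: "finite (nb u)"
  using nb_subset_V finite_V by (rule finite_subset)

text \<open>The second part explains why the algorithm need not check deadlines of neighbours: a
  vertex that passed its deadline unmatched has only matched neighbours, so no active free vertex
  can still see it as a neighbour.\<close>

lemma run_invariant:
  assumes "k \<le> length \<sigma>"
  shows "edges y k \<subseteq> E \<and> (\<forall>v. Deadline v \<in> set (take k \<sigma>) \<longrightarrow> v \<notin> \<Union>(edges y k) \<longrightarrow> nb v \<subseteq> \<Union>(edges y k))"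
  using assms
proof (induction k)
  case (Suc k)
  then have k: "k < length \<sigma>" by simp
  have IH: "edges y k \<subseteq> E" "\<And>v. Deadline v \<in> set (take k \<sigma>) \<Longrightarrow> v \<notin> \<Union>(edges y k) \<Longrightarrow> nb v \<subseteq> \<Union>(edges y k)"
    using Suc by auto
  have tk: "set (take (Suc k) \<sigma>) = insert (\<sigma> ! k) (set (take k \<sigma>))"
    using k by (simp add: take_Suc_conv_app_nth)
  show ?case
  proof (cases "\<sigma> ! k")
    case (Arrival u)
    then show ?thesis unfolding edges_Suc[OF k] step_Arrival[OF k Arrival] tk using IH by auto
  next
    case (Deadline u)
    let ?N = "nb u - \<Union>(edges y k)"
    show ?thesis
    proof (cases "u \<in> \<Union>(edges y k) \<or> ?N = {}")
      case True
      then have "edges y (Suc k) = edges y k" unfolding edges_Suc[OF k] step_Deadline[OF k Deadline] by auto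
      then show ?thesis unfolding tk Deadline using IH True by auto
    next
      case False
      define w where "w = arg_max_on (\<lambda>v. 1 - br_g (y v) - c k v) ?N"
      have w: "w \<in> ?N" unfolding w_def using False finite_nb by (intro arg_max_on_finite) auto
      have e: "edges y (Suc k) = insert {u, w} (edges y k)"
        unfolding edges_Suc[OF k] step_Deadline[OF k Deadline] w_def using False by auto
      have "{u, w} \<in> E" using w by (simp add: nb_def)
      then show ?thesis unfolding e tk Deadline using IH by auto
    qed
  qed
qed simp

lemma feasible_balanced_ranking: "feasible (balanced_ranking br_g fhat) E \<sigma> y"
  unfolding feasible_def Let_def
proof (intro allI impI)
  fix k assume k: "k < length \<sigma>"
  let ?D = "balanced_ranking br_g fhat (observation E (take (Suc k) \<sigma>)) y (edges y k)"
  note inv = run_invariant[of k y]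
  show "matching E ?D \<and> (\<forall>v\<in>\<Union>?D. Arrival v \<in> set (take (Suc k) \<sigma>) \<and> Deadline v \<notin> set (take k \<sigma>)
      \<and> v \<notin> \<Union>(edges y k))"
  proof (cases "\<sigma> ! k")
    case (Arrival u)
    then show ?thesis unfolding step_Arrival[OF k Arrival] by (simp add: matching_def)
  next
    case (Deadline u)
    let ?N = "nb u - \<Union>(edges y k)"
    show ?thesis
    proof (cases "u \<in> \<Union>(edges y k) \<or> ?N = {}")
      case True
      then show ?thesis unfolding step_Deadline[OF k Deadline] by (auto simp: matching_def)
    next
      case False
      define w where "w = arg_max_on (\<lambda>v. 1 - br_g (y v) - c k v) ?N"
      have w: "w \<in> ?N" unfolding w_def using False finite_nb by (intro arg_max_on_finite) auto
      have D: "?D = {{u, w}}" unfolding step_Deadline[OF k Deadline] w_def using False by auto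
      have "set (take k \<sigma>) \<subseteq> set (take (Suc k) \<sigma>)" by (rule set_take_subset_set_take) simp
      then have arr: "Arrival u \<in> set (take (Suc k) \<sigma>)" "Arrival w \<in> set (take (Suc k) \<sigma>)"
        using self_arrived[OF k Deadline] neighbour_arrived[OF k Deadline, of w] w by auto
      have "Deadline u \<notin> set (take k \<sigma>)"
      proof
        assume "Deadline u \<in> set (take k \<sigma>)"
        then obtain i where "i < k" "\<sigma> ! i = Deadline u" by (auto simp: in_set_conv_nth)
        then show False using k Deadline nth_eq_iff_index_eq[OF distinct_\<sigma>, of i k] by simp
      qed
      moreover have "Deadline w \<notin> set (take k \<sigma>)"
      proof
        assume "Deadline w \<in> set (take k \<sigma>)"
        then have "nb w \<subseteq> \<Union>(edges y k)" using inv k w by (metis DiffD2 less_imp_le)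
        then show False using False w nb_sym[of w u] by blast
      qed
      moreover have "{u, w} \<in> E" using w by (simp add: nb_def)
      ultimately show ?thesis unfolding D using arr w False by (auto simp: matching_def disjoint_def)
    qed
  qed
qed

section \<open>Identification of the run with the greedy process\<close>

definition tie_free :: "(nat \<Rightarrow> real) \<Rightarrow> bool" where
  "tie_free y \<longleftrightarrow> (\<forall>k<length \<sigma>. \<forall>v\<in>V. \<forall>w\<in>V. v \<noteq> w \<longrightarrow> br_g (y v) + c k v \<noteq> br_g (y w) + c k w)"

lemma AE_tie_free: "AE y in rank_space. tie_free y"
proof -
  have "AE y in rank_space. \<forall>k\<in>{..<length \<sigma>}. \<forall>v\<in>V. \<forall>w\<in>V. v \<noteq> w \<longrightarrow> br_g (y v) + c k v \<noteq> br_g (y w) + c k w"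
    using AE_rank_no_tie[OF strict_mono_br_g continuous_on_br_g] finite_V
    by (intro AE_finite_allI AE_impI) auto
  then show ?thesis unfolding tie_free_def by (simp only: lessThan_iff Ball_def)
qed

text \<open>Without ties the maximiser is unique, so the two tie-breaking rules agree. Each matching
  step adds an edge at a vertex that was free, hence a new edge, so counting such steps gives the
  size.\<close>

lemma run_eq_matched:
  assumes y: "tie_free y" and "k \<le> length \<sigma>"
  shows "\<Union>(edges y k) = matched {} y k \<and>
    real (card (edges y k)) = (\<Sum>j<k. if match_at j y then 1 else 0)"
  using assms(2)
proof (induction k)
  case 0
  then show ?case by (simp add: bip.matched.simps)
next
  case (Suc k)
  then have k: "k < length \<sigma>" by simp
  have IH: "\<Union>(edges y k) = matched {} y k" "real (card (edges y k)) = (\<Sum>j<k. if match_at j y then 1 else 0)"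
    using Suc by auto
  have fin: "finite (edges y k)" using run_invariant[of k y] k finite_E finite_subset by auto
  show ?case
  proof (cases "\<sigma> ! k")
    case (Arrival u)
    then have "dl k = None" by (simp add: dl_def)
    then have "matched {} y (Suc k) = matched {} y k" "\<not> match_at k y"
      by (auto simp: bip.match_at_def)
    moreover have "edges y (Suc k) = edges y k" unfolding edges_Suc[OF k] step_Arrival[OF k Arrival] by simp
    ultimately show ?thesis using IH by simp
  next
    case (Deadline u)
    then have dl: "dl k = Some u" using k by (simp add: dl_def)
    let ?N = "nb u - matched {} y k"
    show ?thesis
    proof (cases "u \<in> matched {} y k \<or> ?N = {}")
      case True
      then have "edges y (Suc k) = edges y k"
        unfolding edges_Suc[OF k] step_Deadline[OF k Deadline] IH(1) by auto
      moreover have "\<not> match_at k y" using True dl by (auto simp: bip.match_at_def)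
      moreover have "matched {} y (Suc k) = matched {} y k"
        using True dl by (auto simp: bip.sel_def)
      ultimately show ?thesis using IH by simp
    next
      case False
      define w where "w = arg_max_on (\<lambda>v. 1 - br_g (y v) - c k v) ?N"
      have w: "w \<in> ?N" "\<And>x. x \<in> ?N \<Longrightarrow> 1 - br_g (y x) - c k x \<le> 1 - br_g (y w) - c k w"
        unfolding w_def using False finite_nb by (intro arg_max_on_finite; auto)+
      have e: "edges y (Suc k) = insert {u, w} (edges y k)"
        unfolding edges_Suc[OF k] step_Deadline[OF k Deadline] IH(1) w_def using False by auto
      have sel: "sel k y (matched {} y k) u w"
        unfolding bip.sel_def bip.better_def
      proof (intro conjI ballI impI)
        fix x assume x: "x \<in> ?N" "x \<noteq> w"
        have "br_g (y x) + c k x \<noteq> br_g (y w) + c k w"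
        proof -
          have "x \<in> V" "w \<in> V" using x(1) w(1) nb_subset_V by blast+
          then show ?thesis using y k x(2) unfolding tie_free_def by blast
        qed
        then show "br_g (y w) + c k w < br_g (y x) + c k x \<or>
            br_g (y w) + c k w = br_g (y x) + c k x \<and> w < x"
          using w(2)[OF x(1)] by linarith
      qed (rule w(1))
      have sel': "sel k y (matched {} y k) u w' \<longleftrightarrow> w' = w" for w'
        using sel bip.sel_unique by blast
      have "matched {} y (Suc k) = insert u (insert w (matched {} y k))"
        unfolding bip.matched.simps dl using False sel' by auto
      moreover have "match_at k y" using False dl by (auto simp: bip.match_at_def)
      moreover have "{u, w} \<notin> edges y k" using False IH(1) by auto
      ultimately show ?thesis using IH fin unfolding e by auto
    qed
  qed
qed

text \<open>Ties must be handled here, as measurability is claimed on the whole space. The set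
  \<open>Z\<close> of maximisers takes finitely many values, each on a measurable event given by
  comparisons of keys, and together with the current edges it determines the next ones.\<close>

lemma measurable_edges:
  assumes "k \<le> length \<sigma>"
  shows "(\<lambda>y. edges y k) \<in> rank_space \<rightarrow>\<^sub>M count_space (Pow E)"
  using assms
proof (induction k)
  case 0
  then show ?case by simp
next
  case (Suc k)
  then have k: "k < length \<sigma>" by simp
  have IH: "Measurable.pred rank_space (\<lambda>y. edges y k = M)" for M
  proof (cases "M \<in> Pow E")
    case True
    have "(\<lambda>y. edges y k) \<in> rank_space \<rightarrow>\<^sub>M count_space (Pow E)" using Suc by simp
    from measurable_sets[OF this, of "{M}"] True show ?thesis
      by (simp add: pred_def vimage_def Int_def conj_commute)
  next
    case False
    then have "edges y k \<noteq> M" for y using run_invariant[of k y] k by auto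
    then show ?thesis by simp
  qed
  show ?case
  proof (cases "\<sigma> ! k")
    case (Arrival u)
    then show ?thesis unfolding edges_Suc[OF k] step_Arrival[OF k Arrival] using Suc by simp
  next
    case (Deadline u)
    define Z where "Z M y = {x \<in> nb u - \<Union>M. \<forall>w\<in>nb u - \<Union>M. 1 - br_g (y w) - c k w \<le> 1 - br_g (y x) - c k x}" for M y
    define D where "D M z = (if u \<in> \<Union>M \<or> nb u - \<Union>M = {} then {} else {{u, SOME x. x \<in> z}})" for M and z :: "nat set"
    have step: "edges y (Suc k) = edges y k \<union> D (edges y k) (Z (edges y k) y)" for y
      unfolding edges_Suc[OF k] step_Deadline[OF k Deadline] D_def Z_def arg_max_on_eq_Eps by simp
    have Z_sub: "Z M y \<in> Pow (nb u)" for M y by (auto simp: Z_def)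
    have m: "(\<lambda>y. 1 - br_g (y x) - c k x) \<in> borel_measurable rank_space" for x by measurable
    have Z_meas: "Measurable.pred rank_space (\<lambda>y. Z M y = z)" for M z
    proof (cases "z \<subseteq> nb u - \<Union>M")
      case True
      then have eq: "(\<lambda>y. Z M y = z) = (\<lambda>y. \<forall>x\<in>nb u - \<Union>M. (x \<in> z) = (\<forall>w\<in>nb u - \<Union>M. 1 - br_g (y w) - c k w \<le> 1 - br_g (y x) - c k x))"
        by (auto simp: Z_def fun_eq_iff)
      have le: "Measurable.pred rank_space (\<lambda>y. 1 - br_g (y w) - c k w \<le> 1 - br_g (y x) - c k x)" for x w
        unfolding pred_def by (rule borel_measurable_le[OF m m])
      show ?thesis
        unfolding eq using finite_nb le by (intro pred_intros_finite pred_intros_logic measurable_const) auto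
    next
      case False
      then have "(\<lambda>y. Z M y = z) = (\<lambda>y. False)" by (auto simp: Z_def)
      then show ?thesis by simp
    qed
    have "Measurable.pred rank_space (\<lambda>y. edges y (Suc k) = M')" for M'
    proof -
      have "(\<lambda>y. edges y (Suc k) = M') =
        (\<lambda>y. \<exists>M\<in>Pow E. edges y k = M \<and> (\<exists>z\<in>Pow (nb u). Z M y = z \<and> M \<union> D M z = M'))"
        unfolding step using run_invariant[of k] k Z_sub by fastforce
      then show ?thesis
        using IH Z_meas finite_E finite_nb
        by (simp only:, intro pred_intros_finite pred_intros_logic) auto
    qed
    then have "(\<lambda>y. edges y (Suc k)) -` {M'} \<inter> space rank_space \<in> sets rank_space" for M'
      by (simp add: pred_def vimage_def Int_def conj_commute)
    then show ?thesis
      using finite_E run_invariant[of "Suc k"] Suc.prems by (subst measurable_count_space_eq2) auto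
  qed
qed

end

context online_run
begin

lemma water_level_eq:
  assumes "k \<le> length \<sigma>"
  shows "water_level br_g fhat E \<sigma> k v = measure rank_space {y \<in> space rank_space. v \<in> matched {} y k}"
  unfolding water_level_def
proof (rule measure_eq_AE)
  show "AE y in rank_space. (y \<in> {y \<in> space rank_space. v \<in> \<Union>(edges y k)}) =
      (y \<in> {y \<in> space rank_space. v \<in> matched {} y k})"
    using AE_tie_free
  proof eventually_elim
    case (elim y)
    then have "\<Union>(edges y k) = matched {} y k" using run_eq_matched assms by blast
    then show ?case by (simp only: mem_Collect_eq)
  qed
  show "{y \<in> space rank_space. v \<in> matched {} y k} \<in> sets rank_space"
    using bip.measurable_matched[OF continuous_on_br_g] by (simp add: pred_def)
  have "Measurable.pred (count_space (Pow E)) (\<lambda>M. v \<in> \<Union>M)" by simp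
  from measurable_compose[OF measurable_edges[OF assms] this]
  show "{y \<in> space rank_space. v \<in> \<Union>(edges y k)} \<in> sets rank_space" by (simp add: pred_def)
qed

lemma expected_run_size_ge:
  assumes consistent: "\<And>k u v. k < length \<sigma> \<Longrightarrow> \<sigma> ! k = Deadline u \<Longrightarrow> v \<in> nb u \<Longrightarrow>
      br_f (water_level br_g fhat E \<sigma> (Suc k) v) = c k v"
    and M: "matching E M"
  shows "569/1000 * real (card M) \<le> (\<integral>y. real (card (edges y (length \<sigma>))) \<partial>rank_space)"
proof -
  have inj: "i = j" if "dl i = Some u" "dl j = Some u" for i j u
    using that nth_eq_iff_index_eq[OF distinct_\<sigma>, of i j] by (auto simp: dl_eq_Some)
  interpret bal: balanced_process dl nb c L R V "length \<sigma>"
  proof unfold_locales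
    show "u \<in> V" if "dl j = Some u" for j u
      using that set_\<sigma> nth_mem[of j \<sigma>] by (auto simp: dl_eq_Some)
    show "i = j" if "dl i = Some u" "dl j = Some u" for i j u using that by (rule inj)
    show "c j w = br_f (measure rank_space {y \<in> space rank_space. w \<in> matched {} y (Suc j)})"
      if "dl j = Some u" "w \<in> nb u" for j u w
      using consistent[of j u w] that water_level_eq[of "Suc j" w] by (auto simp: dl_eq_Some Suc_le_eq)
  qed (use finite_V nb_subset_V in \<open>auto simp: dl_eq_Some\<close>)
  have "569/1000 * real (card M) \<le> (\<integral>y. (\<Sum>j<length \<sigma>. if match_at j y then 1 else 0) \<partial>rank_space)"
  proof (rule bal.expected_matches_ge)
    show "finite M" "disjoint M" using M finite_E by (auto simp: matching_def intro: finite_subset)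
    fix e assume "e \<in> M"
    then have "e \<in> E" using M by (auto simp: matching_def)
    then obtain a b where e: "a \<in> L" "b \<in> R" "e = {a, b}" using E_LR by blast
    then have ab: "e = {a, b}" "b \<in> nb a" "a \<noteq> b" using \<open>e \<in> E\<close> LR_disj by (auto simp: nb_def)
    have "\<exists>i. dl i = Some x" if "x \<in> V" for x
    proof -
      have "Deadline x \<in> set \<sigma>" using that set_\<sigma> by auto
      then show ?thesis by (auto simp: dl_eq_Some in_set_conv_nth)
    qed
    then obtain i j where ij: "dl i = Some a" "dl j = Some b"
      using ab nb_subset_V nb_nonempty_V by blast
    have key: "\<exists>u v d. {u', v'} = {u, v} \<and> v \<in> nb u \<and> dl d = Some u \<and> (\<forall>j\<le>d. dl j \<noteq> Some v)"
      if "v' \<in> nb u'" "dl i' = Some u'" "dl j' = Some v'" "i' < j'" for u' v' i' j'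
    proof -
      have "\<forall>j\<le>i'. dl j \<noteq> Some v'" using inj[OF _ that(3)] that(4) by fastforce
      then show ?thesis using that(1,2) by blast
    qed
    have "i \<noteq> j" using ij ab by auto
    then consider "i < j" | "j < i" by linarith
    then show "\<exists>u v d. e = {u, v} \<and> v \<in> nb u \<and> dl d = Some u \<and> (\<forall>j\<le>d. dl j \<noteq> Some v)"
    proof cases
      case 1
      then show ?thesis unfolding ab(1) using ab(2) ij by (intro key)
    next
      case 2
      have "\<exists>u v d. {b, a} = {u, v} \<and> v \<in> nb u \<and> dl d = Some u \<and> (\<forall>j\<le>d. dl j \<noteq> Some v)"
        using 2 ab(2) ij nb_sym by (intro key) auto
      then show ?thesis unfolding ab(1) by (simp add: insert_commute)
    qed
  qed
  also have "\<dots> = (\<integral>y. real (card (edges y (length \<sigma>))) \<partial>rank_space)"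
  proof (rule integral_cong_AE)
    have [measurable]: "Measurable.pred rank_space (match_at j)" for j
    proof -
      have "match_at j = (\<lambda>y. case dl j of None \<Rightarrow> False
          | Some u \<Rightarrow> u \<notin> matched {} y j \<and> (\<exists>w\<in>nb u. w \<notin> matched {} y j))"
        by (auto simp: bip.match_at_def fun_eq_iff split: option.splits)
      moreover have "Measurable.pred rank_space (\<lambda>y. u \<notin> matched {} y j \<and> (\<exists>w\<in>nb u. w \<notin> matched {} y j))" for u
        using finite_nb bip.measurable_matched[OF continuous_on_br_g]
        by (intro pred_intros_logic pred_intros_finite) auto
      ultimately show ?thesis by (cases "dl j") auto
    qed
    show "(\<lambda>y. \<Sum>j<length \<sigma>. if match_at j y then 1 else 0 :: real) \<in> borel_measurable rank_space"
      by measurable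
    show "(\<lambda>y. real (card (edges y (length \<sigma>)))) \<in> borel_measurable rank_space"
      by (rule measurable_compose[OF measurable_edges]) simp_all
    show "AE y in rank_space. (\<Sum>j<length \<sigma>. if match_at j y then 1 else 0) = real (card (edges y (length \<sigma>)))"
      using AE_tie_free by eventually_elim (use run_eq_matched in auto)
  qed
  finally show ?thesis .
qed

end

lemma (in online_instance) max_matching_obtain:
  obtains M where "matching E M" "max_matching_size E = card M"
proof -
  have "finite {M. matching E M}"
    using finite_E by (intro finite_subset[of "{M. matching E M}" "Pow E"]) (auto simp: matching_def)
  moreover have "matching E {}" by (simp add: matching_def)
  ultimately have "max_matching_size E \<in> card ` {M. matching E M}"
    unfolding max_matching_size_def by (intro Max_in) auto
  then show ?thesis using that by auto
qed

lemma online_instance_exists: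
  assumes "fully_online_instance V E \<sigma>" "bipartite V E"
  obtains L R where "online_instance V E \<sigma> L R"
proof -
  from assms(2) obtain L R where "V = L \<union> R" "L \<inter> R = {}" "\<forall>e\<in>E. \<exists>u\<in>L. \<exists>v\<in>R. e = {u, v}"
    by (auto simp: bipartite_def)
  with assms(1) show ?thesis by (intro that[of L R]) (simp add: online_instance_def)
qed

lemma competitive_balanced_ranking:
  assumes "self_consistent bipartite br_f br_g fhat"
  shows "competitive bipartite rank_space (balanced_ranking br_g fhat) (569/1000)"
  unfolding competitive_def
proof (intro conjI allI impI ballI)
  show "prob_space rank_space" by (rule rank_space.prob_space_axioms)
next
  fix V E \<sigma> y assume "fully_online_instance V E \<sigma> \<and> bipartite V E"
  then obtain L R where "online_instance V E \<sigma> L R" using online_instance_exists by blast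
  then interpret online_run V E \<sigma> L R fhat by (simp add: online_run_def)
  show "feasible (balanced_ranking br_g fhat) E \<sigma> y" by (rule feasible_balanced_ranking)
next
  fix V E \<sigma> assume inst': "fully_online_instance V E \<sigma> \<and> bipartite V E"
  then obtain L R where "online_instance V E \<sigma> L R" using online_instance_exists by blast
  then interpret online_run V E \<sigma> L R fhat by (simp add: online_run_def)
  obtain M where M: "matching E M" "max_matching_size E = card M" by (rule max_matching_obtain)
  have "569/1000 * real (card M) \<le> (\<integral>y. real (card (edges y (length \<sigma>))) \<partial>rank_space)"
  proof (rule expected_run_size_ge[OF _ M(1)])
    show "br_f (water_level br_g fhat E \<sigma> (Suc k) v) = c k v"
      if "k < length \<sigma>" "\<sigma> ! k = Deadline u" "v \<in> nb u" for k u v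
      using assms inst' that unfolding self_consistent_def c_def nb_def by blast
  qed
  then show "569/1000 * real (max_matching_size E) \<le>
      (\<integral>y. real (card (run (balanced_ranking br_g fhat) E \<sigma> y (length \<sigma>))) \<partial>rank_space)"
    by (simp only: M(2))
qed

section \<open>Existence of the lookahead values\<close>

text \<open>Solving every single coordinate turns the system into a monotone one, to which the
  Knaster-Tarski argument applies.\<close>

lemma coordinatewise_fixed_point:
  fixes h :: "'a \<Rightarrow> ('a \<Rightarrow> real) \<Rightarrow> real"
  assumes range: "\<And>v x. v \<in> N \<Longrightarrow> h v x \<in> {0..1}"
    and anti: "\<And>v x s t. v \<in> N \<Longrightarrow> s \<le> t \<Longrightarrow> h v (x(v := t)) \<le> h v (x(v := s))"
    and mono: "\<And>v x x' t. v \<in> N \<Longrightarrow> (\<And>w. x w \<le> x' w) \<Longrightarrow> h v (x(v := t)) \<le> h v (x'(v := t))"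
    and cont: "\<And>v x. v \<in> N \<Longrightarrow> continuous_on {0..1} (\<lambda>t. h v (x(v := t)))"
  obtains x where "\<And>v. v \<in> N \<Longrightarrow> h v x = x v"
proof -
  have "\<exists>t\<in>{0..1}. h v (x(v := t)) = t" if v: "v \<in> N" for v x
  proof -
    have "\<exists>t. 0 \<le> t \<and> t \<le> 1 \<and> t - h v (x(v := t)) = 0"
    proof (rule IVT')
      show "0 - h v (x(v := 0)) \<le> 0" "0 \<le> 1 - h v (x(v := 1))" using range[OF v] by auto
      show "continuous_on {0..1} (\<lambda>t. t - h v (x(v := t)))" by (intro continuous_intros cont v)
    qed simp
    then obtain t where "0 \<le> t" "t \<le> 1" "t - h v (x(v := t)) = 0" by blast
    then show ?thesis by (intro bexI[of _ t]) auto
  qed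
  then obtain \<Phi> where \<Phi>: "\<And>v x. v \<in> N \<Longrightarrow> \<Phi> v x \<in> {0..1} \<and> h v (x(v := \<Phi> v x)) = \<Phi> v x"
    by metis
  \<comment> \<open>This holds for any choice of solutions: if the solution for the larger argument
    were smaller, antitonicity in the own coordinate and monotonicity in the others would contradict
    the two fixed-point equations.\<close>
  have \<Phi>_mono: "\<Phi> v x \<le> \<Phi> v x'" if v: "v \<in> N" and le: "\<And>w. x w \<le> x' w" for v x x'
  proof (rule ccontr)
    assume "\<not> \<Phi> v x \<le> \<Phi> v x'"
    then have "h v (x'(v := \<Phi> v x)) \<le> h v (x'(v := \<Phi> v x'))" by (intro anti v) simp
    moreover have "h v (x(v := \<Phi> v x)) \<le> h v (x'(v := \<Phi> v x))" by (intro mono v le)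
    ultimately show False using \<Phi>[OF v, of x, THEN conjunct2] \<Phi>[OF v, of x', THEN conjunct2] \<open>\<not> \<Phi> v x \<le> \<Phi> v x'\<close> by linarith
  qed
  \<comment> \<open>These are the points lying below their image. Coordinates outside
    \<open>N\<close> are pinned to \<open>0\<close>, so that the pointwise supremum exists
    everywhere.\<close>
  define A where "A = {x. (\<forall>v. 0 \<le> x v \<and> x v \<le> 1) \<and> (\<forall>v. v \<notin> N \<longrightarrow> x v = 0) \<and> (\<forall>v\<in>N. x v \<le> \<Phi> v x)}"
  have zero: "(\<lambda>_. 0) \<in> A" using \<Phi> by (auto simp: A_def)
  define z where "z v = (SUP x\<in>A. x v)" for v
  have bdd: "bdd_above ((\<lambda>x. x v) ` A)" for v
    by (rule bdd_aboveI[of _ 1]) (auto simp: A_def)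
  have le_z: "x v \<le> z v" if "x \<in> A" for x v
    unfolding z_def using that bdd by (intro cSUP_upper)
  have z_le: "z v \<le> \<Phi> v z" if v: "v \<in> N" for v
    unfolding z_def[of v]
  proof (rule cSUP_least)
    fix x assume x: "x \<in> A"
    then have "x v \<le> \<Phi> v x" using v by (auto simp: A_def)
    also have "\<dots> \<le> \<Phi> v z" using le_z[OF x] by (intro \<Phi>_mono v)
    finally show "x v \<le> \<Phi> v z" .
  qed (use zero in auto)
  have z_out: "z v = 0" if "v \<notin> N" for v
  proof -
    have "(\<lambda>x. x v) ` A = {0}" using that zero by (auto simp: A_def)
    then show ?thesis by (simp add: z_def)
  qed
  \<comment> \<open>The image of the supremum lies in \<open>A\<close> again and hence below the
    supremum.\<close>
  define z' where "z' v = (if v \<in> N then \<Phi> v z else 0)" for v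
  have "z v \<le> z' v" for v using z_le z_out by (simp add: z'_def)
  then have "z' \<in> A" using \<Phi> \<Phi>_mono[of _ z z'] by (auto simp: A_def z'_def)
  then have "\<Phi> v z \<le> z v" if "v \<in> N" for v using le_z[of z' v] that by (simp add: z'_def)
  then have "\<Phi> v z = z v" if "v \<in> N" for v using z_le that by (intro antisym) auto
  then have "h v z = z v" if "v \<in> N" for v using \<Phi>[OF that, of z] that by simp
  then show ?thesis by (rule that)
qed

lemma (in online_instance) matched_offset_cong:
  assumes "\<And>j. j < k \<Longrightarrow> c j = c' j"
  shows "greedy_process.matched dl nb c br_g X y k = greedy_process.matched dl nb c' br_g X y k"
  using assms
proof (induction k)
  case (Suc k)
  have "greedy_process.sel nb c br_g k y S u w = greedy_process.sel nb c' br_g k y S u w" for S u w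
    using Suc.prems[of k] unfolding bip.sel_def bip.better_def by simp
  then show ?case using Suc by (simp add: bip.matched.simps)
qed (simp add: bip.matched.simps)

context online_run
begin

definition step_level :: "nat \<Rightarrow> nat \<Rightarrow> (nat \<Rightarrow> real) \<Rightarrow> real" where
  "step_level k v x = measure rank_space
     {y \<in> space rank_space. v \<in> greedy_process.matched dl nb (c(k := x)) br_g {} y (Suc k)}"

lemma step_level_sets:
  "{y \<in> space rank_space. v \<in> greedy_process.matched dl nb (c(k := x)) br_g {} y j} \<in> sets rank_space"
  using bip.measurable_matched[OF continuous_on_br_g] by (simp add: pred_def)

text \<open>Earlier steps do not see \<open>x\<close>, so \<open>x\<close> enters only through the
  comparisons of \<open>v\<close> with its competitors. Monotonicity and continuity can be read off
  from these.\<close>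

lemma matched_step_iff:
  assumes "dl k = Some u" "v \<in> nb u"
  shows "v \<in> greedy_process.matched dl nb (c(k := x)) br_g {} y (Suc k) \<longleftrightarrow>
    v \<in> matched {} y k \<or> u \<notin> matched {} y k \<and> v \<notin> matched {} y k \<and>
      (\<forall>w\<in>nb u. w \<notin> matched {} y k \<longrightarrow> w \<noteq> v \<longrightarrow> br_g (y v) + x v < br_g (y w) + x w \<or>
        br_g (y v) + x v = br_g (y w) + x w \<and> v < w)"
proof -
  have "greedy_process.matched dl nb (c(k := x)) br_g {} y k = matched {} y k"
    by (rule matched_offset_cong) simp
  moreover have "v \<noteq> u" using assms(2) bip.not_in_nb_self by auto
  ultimately show ?thesis
    using assms unfolding bip.matched.simps bip.sel_def bip.better_def by auto
qed

lemma step_level_antimono: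
  assumes "dl k = Some u" "v \<in> nb u" "s \<le> t"
  shows "step_level k v (x(v := t)) \<le> step_level k v (x(v := s))"
  unfolding step_level_def
proof (rule rank_space.finite_measure_mono[OF _ step_level_sets], rule Collect_mono, intro impI)
  fix y
  assume "y \<in> space rank_space \<and> v \<in> greedy_process.matched dl nb (c(k := x(v := t))) br_g {} y (Suc k)"
  then show "y \<in> space rank_space \<and> v \<in> greedy_process.matched dl nb (c(k := x(v := s))) br_g {} y (Suc k)"
    unfolding matched_step_iff[OF assms(1,2)] using assms(3) by force
qed

lemma step_level_mono:
  assumes "dl k = Some u" "v \<in> nb u" "\<And>w. x w \<le> x' w"
  shows "step_level k v (x(v := t)) \<le> step_level k v (x'(v := t))"
  unfolding step_level_def
proof (rule rank_space.finite_measure_mono[OF _ step_level_sets], rule Collect_mono, intro impI)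
  fix y
  assume "y \<in> space rank_space \<and> v \<in> greedy_process.matched dl nb (c(k := x(v := t))) br_g {} y (Suc k)"
  moreover have "br_g (y v) + t < br_g (y w) + x' w \<or> br_g (y v) + t = br_g (y w) + x' w \<and> v < w"
    if "br_g (y v) + t < br_g (y w) + x w \<or> br_g (y v) + t = br_g (y w) + x w \<and> v < w" for w
    using that assms(3)[of w] by linarith
  ultimately show "y \<in> space rank_space \<and> v \<in> greedy_process.matched dl nb (c(k := x'(v := t))) br_g {} y (Suc k)"
    unfolding matched_step_iff[OF assms(1,2)] by fastforce
qed

text \<open>Dominated convergence: off the null set of ties at \<open>a\<close>, the finitely many
  comparisons are strict and thus eventually constant along the sequence, so the indicators are
  too.\<close>

lemma step_level_continuous:
  assumes u: "dl k = Some u" and v: "v \<in> nb u"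
  shows "continuous_on {0..1} (\<lambda>t. step_level k v (x(v := t)))"
  unfolding continuous_on_sequentially
proof (intro allI ballI impI, elim conjE)
  fix s :: "nat \<Rightarrow> real" and a assume s: "s \<longlonglongrightarrow> a"
  let ?A = "\<lambda>t. {y \<in> space rank_space. v \<in> greedy_process.matched dl nb (c(k := x(v := t))) br_g {} y (Suc k)}"
  have I: "(\<integral>y. indicator (?A t) y \<partial>rank_space) = step_level k v (x(v := t))" for t
    using step_level_sets[of v k "x(v := t)" "Suc k"] unfolding step_level_def
    by (subst Bochner_Integration.integral_indicator) (auto simp: rank_space.emeasure_eq_measure Int_absorb2)
  have "(\<lambda>n. \<integral>y. indicator (?A (s n)) y \<partial>rank_space) \<longlonglongrightarrow> (\<integral>y. (indicator (?A a) y :: real) \<partial>rank_space)"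
  proof (rule integral_dominated_convergence[where w = "\<lambda>_. 1"])
    show "(indicator (?A a) :: _ \<Rightarrow> real) \<in> borel_measurable rank_space"
      by (rule borel_measurable_indicator[OF step_level_sets])
    show "(indicator (?A (s n)) :: _ \<Rightarrow> real) \<in> borel_measurable rank_space" for n
      by (rule borel_measurable_indicator[OF step_level_sets])
    show "AE y in rank_space. norm (indicator (?A (s n)) y :: real) \<le> 1" for n
      by (rule AE_I2) (simp only: indicator_def of_bool_def, simp)
    have "AE y in rank_space. \<forall>w\<in>nb u. w \<noteq> v \<longrightarrow> br_g (y v) + a \<noteq> br_g (y w) + x w"
      using finite_nb AE_rank_no_tie[OF strict_mono_br_g continuous_on_br_g]
      by (intro AE_finite_allI AE_impI) auto
    then show "AE y in rank_space. (\<lambda>n. indicator (?A (s n)) y) \<longlonglongrightarrow> (indicator (?A a) y :: real)"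
    proof eventually_elim
      case (elim y)
      have lim: "(\<lambda>n. br_g (y v) + s n) \<longlonglongrightarrow> br_g (y v) + a" by (intro tendsto_intros s)
      let ?P = "\<lambda>t w. w \<noteq> v \<longrightarrow> br_g (y v) + t < br_g (y w) + x w \<or> br_g (y v) + t = br_g (y w) + x w \<and> v < w"
      have "\<forall>\<^sub>F n in sequentially. ?P (s n) w = ?P a w" if w: "w \<in> nb u" for w
      proof (cases "w = v")
        case False
        then consider "br_g (y v) + a < br_g (y w) + x w" | "br_g (y w) + x w < br_g (y v) + a"
          using elim w by fastforce
        then show ?thesis
        proof cases
          case 1
          from order_tendstoD(2)[OF lim 1] show ?thesis by eventually_elim (use 1 in auto)
        next
          case 2
          from order_tendstoD(1)[OF lim 2] show ?thesis by eventually_elim (use 2 False in auto)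
        qed
      qed simp
      then have "\<forall>\<^sub>F n in sequentially. \<forall>w\<in>nb u. ?P (s n) w = ?P a w"
        using finite_nb by (intro eventually_ball_finite) auto
      then have "\<forall>\<^sub>F n in sequentially. indicator (?A (s n)) y = (indicator (?A a) y :: real)"
      proof eventually_elim
        case (elim n)
        have "y \<in> ?A (s n) \<longleftrightarrow> y \<in> ?A a"
          unfolding mem_Collect_eq matched_step_iff[OF u v] using elim by auto
        then show ?case by (simp only: indicator_def of_bool_def)
      qed
      then show ?case by (rule tendsto_eventually)
    qed
  qed simp
  then show "((\<lambda>t. step_level k v (x(v := t))) \<circ> s) \<longlonglongrightarrow> step_level k v (x(v := a))"
    unfolding I by (simp add: o_def)
qed

lemma continuous_on_br_f: "continuous_on A br_f"
  unfolding br_f_def by (intro continuous_intros)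

lemma consistent_step_exists:
  assumes u: "dl k = Some u"
  obtains x where "\<And>v. v \<in> nb u \<Longrightarrow> br_f (step_level k v x) = x v"
proof (rule coordinatewise_fixed_point[of "nb u" "\<lambda>v x. br_f (step_level k v x)"])
  fix v assume v: "v \<in> nb u"
  have nonneg: "0 \<le> step_level k v x" for x by (simp add: step_level_def)
  show "br_f (step_level k v x) \<in> {0..1}" for x
    using br_f_bounds(1)[OF nonneg, of x] br_f_bounds(2)[of "step_level k v x"] by simp
  show "br_f (step_level k v (x(v := t))) \<le> br_f (step_level k v (x(v := s)))" if "s \<le> t" for x s t
    by (intro monoD[OF mono_br_f] step_level_antimono[OF u v that])
  show "br_f (step_level k v (x(v := t))) \<le> br_f (step_level k v (x'(v := t)))" if "\<And>w. x w \<le> x' w" for x x' t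
    by (intro monoD[OF mono_br_f] step_level_mono[OF u v that])
  show "continuous_on {0..1} (\<lambda>t. br_f (step_level k v (x(v := t))))" for x
    by (rule continuous_on_compose2[OF continuous_on_br_f step_level_continuous[OF u v]]) auto
qed (rule that)

end

section \<open>Dependence on the observations alone\<close>

lemma run_balanced_ranking_cong:
  assumes "\<And>i. i < k \<Longrightarrow> observation E (take (Suc i) \<sigma>) = observation E' (take (Suc i) \<sigma>')"
    and "\<And>i. i < k \<Longrightarrow> F (observation E (take (Suc i) \<sigma>)) = F' (observation E (take (Suc i) \<sigma>))"
  shows "run (balanced_ranking g F) E \<sigma> y k = run (balanced_ranking g F') E' \<sigma>' y k"
  using assms
proof (induction k)
  case (Suc k)
  then have "run (balanced_ranking g F) E \<sigma> y k = run (balanced_ranking g F') E' \<sigma>' y k" by simp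
  moreover have "balanced_ranking g F (observation E (take (Suc k) \<sigma>)) y M =
      balanced_ranking g F' (observation E (take (Suc k) \<sigma>)) y M" for M
    unfolding balanced_ranking_def by (simp only: Suc.prems(2)[OF lessI])
  ultimately show ?case using Suc.prems(1)[of k] by simp
qed simp

lemma water_level_cong:
  assumes "\<And>i. i < k \<Longrightarrow> observation E (take (Suc i) \<sigma>) = observation E' (take (Suc i) \<sigma>')"
    and "\<And>i. i < k \<Longrightarrow> F (observation E (take (Suc i) \<sigma>)) = F' (observation E (take (Suc i) \<sigma>))"
  shows "water_level g F E \<sigma> k v = water_level g F' E' \<sigma>' k v"
proof -
  have "run (balanced_ranking g F) E \<sigma> y k = run (balanced_ranking g F') E' \<sigma>' y k" for y
    by (rule run_balanced_ranking_cong) (fact assms)+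
  then show ?thesis unfolding water_level_def by simp
qed

text \<open>The revealed steps and subgraph can themselves be used as input; all earlier
  observations are then unchanged.\<close>

lemma observation_observation:
  "i \<le> k \<Longrightarrow> observation (snd (observation E (take k \<sigma>))) (take i (fst (observation E (take k \<sigma>)))) = observation E (take i \<sigma>)"
  using set_take_subset_set_take[of i k \<sigma>] by (auto simp: observation_def min_absorb1)

text \<open>Stated without reference to the underlying instance, so that one choice of
  \<open>x\<close> serves all instances with this observation. \<open>F\<close> provides the numbers
  of the earlier steps.\<close>

definition consistent_at ::
  "(observation \<Rightarrow> nat \<Rightarrow> real) \<Rightarrow> observation \<Rightarrow> (nat \<Rightarrow> real) \<Rightarrow> bool" where
  "consistent_at F obs x \<longleftrightarrow> (\<forall>u v. last (fst obs) = Deadline u \<and> {u, v} \<in> snd obs \<longrightarrow>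
     br_f (water_level br_g (F(obs := x)) (snd obs) (fst obs) (length (fst obs)) v) = x v)"

lemma length_fst_observation: "k \<le> length \<sigma> \<Longrightarrow> length (fst (observation E (take k \<sigma>))) = k"
  by (simp add: observation_def)

text \<open>A prefix need not be a complete instance, so the fixed point is found in an instance
  that produces the observation. The water levels are then transferred, because they depend only on
  the observations so far.\<close>

lemma consistent_at_exists:
  assumes "fully_online_instance V E \<sigma>" "bipartite V E" "k < length \<sigma>"
  shows "\<exists>x. consistent_at F (observation E (take (Suc k) \<sigma>)) x"
proof -
  obtain L R where "online_instance V E \<sigma> L R" using online_instance_exists assms by blast
  then interpret online_run V E \<sigma> L R F by (simp add: online_run_def)
  let ?obs = "observation E (take (Suc k) \<sigma>)"
  have k: "k < length \<sigma>" by fact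
  show ?thesis
  proof (cases "\<sigma> ! k")
    case (Arrival u)
    then show ?thesis using last_observation[OF k] by (simp add: consistent_at_def)
  next
    case (Deadline u)
    then have dl: "dl k = Some u" using k by (simp add: dl_eq_Some)
    obtain x where x: "\<And>v. v \<in> nb u \<Longrightarrow> br_f (step_level k v x) = x v"
      using consistent_step_exists[OF dl] by blast
    let ?F' = "F(?obs := x)"
    interpret upd: online_run V E \<sigma> L R ?F' by unfold_locales
    \<comment> \<open>Observations after different numbers of steps have different lengths, so the
      update at \<open>?obs\<close> affects only step \<open>k\<close>.\<close>
    have c': "upd.c j = (c(k := x)) j" if "j < Suc k" for j
    proof (cases "j = k")
      case False
      then have "observation E (take (Suc j) \<sigma>) \<noteq> ?obs"
        using that k length_fst_observation[of "Suc j" \<sigma> E] length_fst_observation[of "Suc k" \<sigma> E] by force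
      then show ?thesis using False by (simp add: upd.c_def c_def)
    qed (simp add: upd.c_def)
    have "water_level br_g ?F' E \<sigma> (Suc k) v = step_level k v x" for v
    proof -
      have "greedy_process.matched dl nb upd.c br_g {} y (Suc k) =
          greedy_process.matched dl nb (c(k := x)) br_g {} y (Suc k)" for y
        by (rule matched_offset_cong) (rule c')
      then show ?thesis
        using upd.water_level_eq[of "Suc k" v] k unfolding step_level_def by (simp only: Suc_le_eq)
    qed
    moreover have "water_level br_g ?F' (snd ?obs) (fst ?obs) (Suc k) v = water_level br_g ?F' E \<sigma> (Suc k) v" for v
      by (intro water_level_cong) (simp_all only: observation_observation less_Suc_eq_le Suc_le_mono)
    ultimately have "consistent_at F ?obs x"
      unfolding consistent_at_def
      using x last_observation[OF k] Deadline observed_neighbours[OF k Deadline] k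
        length_fst_observation[of "Suc k" \<sigma> E] by (simp add: Suc_le_eq)
    then show ?thesis by blast
  qed
qed

text \<open>Recursion on the number of revealed steps: the water levels after a step depend on the numbers
  used in all earlier ones.\<close>

primrec lookahead_upto :: "nat \<Rightarrow> observation \<Rightarrow> nat \<Rightarrow> real" where
  "lookahead_upto 0 = (\<lambda>_ _. 0)"
| "lookahead_upto (Suc n) = (\<lambda>obs. if length (fst obs) = Suc n
     then (SOME x. consistent_at (lookahead_upto n) obs x) else lookahead_upto n obs)"

definition lookahead :: "observation \<Rightarrow> nat \<Rightarrow> real" where
  "lookahead obs = lookahead_upto (length (fst obs)) obs"

lemma lookahead_upto_eq: "length (fst obs) \<le> n \<Longrightarrow> lookahead_upto n obs = lookahead obs"
proof (induction n)
  case (Suc n)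
  then show ?case by (cases "length (fst obs) = Suc n") (auto simp: lookahead_def)
qed (simp add: lookahead_def)

lemma self_consistent_lookahead: "self_consistent bipartite br_f br_g lookahead"
  unfolding self_consistent_def
proof (intro allI impI, elim conjE)
  fix V E \<sigma> k u v
  assume inst': "fully_online_instance V E \<sigma>" "bipartite V E" and k: "k < length \<sigma>"
    and dl: "\<sigma> ! k = Deadline u" and e: "{u, v} \<in> E"
  obtain L R where "online_instance V E \<sigma> L R" using online_instance_exists inst' by blast
  then interpret online_instance V E \<sigma> L R .
  let ?obs = "observation E (take (Suc k) \<sigma>)"
  let ?F = "lookahead_upto k"
  have len: "length (fst ?obs) = Suc k" using k by (intro length_fst_observation) simp
  have "consistent_at ?F ?obs (SOME x. consistent_at ?F ?obs x)"
    using consistent_at_exists[OF inst' k] by (rule someI_ex)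
  moreover have "(SOME x. consistent_at ?F ?obs x) = lookahead ?obs"
    unfolding lookahead_def len by (simp add: len)
  ultimately have "consistent_at ?F ?obs (lookahead ?obs)" by simp
  then have "br_f (water_level br_g (?F(?obs := lookahead ?obs)) (snd ?obs) (fst ?obs) (Suc k) v) = lookahead ?obs v"
    unfolding consistent_at_def len
    using last_observation[OF k] dl observed_neighbours[OF k dl] e by (simp add: nb_def)
  also have "water_level br_g (?F(?obs := lookahead ?obs)) (snd ?obs) (fst ?obs) (Suc k) v =
      water_level br_g lookahead E \<sigma> (Suc k) v"
  proof (rule water_level_cong)
    fix i assume i: "i < Suc k"
    show obs_eq: "observation (snd ?obs) (take (Suc i) (fst ?obs)) = observation E (take (Suc i) \<sigma>)"
      using i by (intro observation_observation) simp
    show "(?F(?obs := lookahead ?obs)) (observation (snd ?obs) (take (Suc i) (fst ?obs))) =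
        lookahead (observation (snd ?obs) (take (Suc i) (fst ?obs)))"
    proof (cases "i = k")
      case False
      \<comment> \<open>Earlier observations are strictly shorter, so they escape the update and
        their values are already final at stage \<open>k\<close>.\<close>
      have "length (fst (observation E (take (Suc i) \<sigma>))) = Suc i"
        using i k by (intro length_fst_observation) simp
      then have "observation E (take (Suc i) \<sigma>) \<noteq> ?obs" "length (fst (observation E (take (Suc i) \<sigma>))) \<le> k"
        using False i len by auto
      then show ?thesis unfolding obs_eq using lookahead_upto_eq by simp
    qed (unfold obs_eq, simp)
  qed
  finally show "br_f (water_level br_g lookahead E \<sigma> (Suc k) v) = lookahead ?obs v" .
qed

theorem theorem1:
  "\<exists>f g :: real \<Rightarrow> real.
     f \<in> {0..1} \<rightarrow> {0..1} \<and> mono_on {0..1} f \<and>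
     g \<in> {0..1} \<rightarrow> {0..1} \<and> strict_mono_on {0..1} g \<and>
     balanced_ranking_competitive bipartite f g 0.569"
proof (rule exI[of _ br_f], rule exI[of _ br_g], intro conjI)
  show "br_f \<in> {0..1} \<rightarrow> {0..1}"
  proof
    fix x :: real assume "x \<in> {0..1}"
    then show "br_f x \<in> {0..1}" using br_f_bounds[of x] by simp
  qed
  show "br_g \<in> {0..1} \<rightarrow> {0..1}"
  proof
    fix x :: real assume "x \<in> {0..1}"
    then show "br_g x \<in> {0..1}" using br_g_bounds[of x] by simp
  qed
  show "mono_on {0..1} br_f" by (rule mono_on_subset[OF mono_br_f]) simp
  show "strict_mono_on {0..1} br_g" by (rule strict_mono_br_g)
  show "balanced_ranking_competitive bipartite br_f br_g 0.569"
    unfolding balanced_ranking_competitive_def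
    using self_consistent_lookahead competitive_balanced_ranking by auto
qed

end
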